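(* There is a polynomial time reduction which, given a graph $G=(V,E)$ with $n$ vertices and $m$ edges, outputs a graph $G'$ with $n$ vertices and $O(m+n^2)$ edges, a cost vector $c$ assigning a number in $\mathbb{N}$ to each edge of $G'$, with $\|c\|_1\le 2^{O(m\log m)}$, and a value $C\in\mathbb{N}$, such that $$PM(G)=\alpha\cdot ST_C(G'),$$ where $PM(G)$ denotes the number of perfect matchings in $G$, $ST_C(G')$ denotes the number of spanning trees of total cost $C$ in $G'$, and $\alpha=\frac{n^2}{2}(2n)^{-n/2}$.
   Context: Graphs are undirected, and $G'$ may have parallel edges. The total cost of a spanning tree is the sum of the costs of its edges, and $\|c\|_1$ is the sum of the costs of all edges of $G'$. $\mathbb{N}$ denotes the nonnegative integers. *)

theory Defs
  imports
    Complex_Main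
    "HOL-Library.Landau_Symbols"
    "HOL-Library.Log_Nat"
    "HOL-Computational_Algebra.Polynomial"
begin

section \<open>Polynomial time\<close>

text \<open>
  The machine model is the random access machine of Cook--Reckhow and
  Aho--Hopcroft--Ullman under the logarithmic cost criterion, which is polynomially
  equivalent to the multitape Turing machine. Registers, input squares and output
  squares hold natural numbers of arbitrary size, and every instruction is charged the
  number of binary digits of the values (including computed addresses) that it handles.
  Addresses and constants written in the program do not depend on the input; they are
  charged as a constant. Control flow is structured instead of using labels and jumps.
\<close>

datatype ram =
    Const nat nat
  | Add nat nat nat
  | Sub nat nat nat
  | Load nat nat
  | Store nat nat
  | Read nat
  | Write nat
  | Seq ram ram
  | Cond nat ram ram
  | While nat ram

text \<open>A configuration: registers, unread part of the input tape, output written so far.\<close>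

type_synonym config = "(nat \<Rightarrow> nat) \<times> nat list \<times> nat list"

abbreviation digits :: "nat \<Rightarrow> nat" where
  "digits \<equiv> floorlog 2"

text \<open>
  \<open>exec p s t s'\<close>: started in configuration \<open>s\<close>, program \<open>p\<close> halts in configuration \<open>s'\<close>
  after a run of total cost \<open>t\<close>. Reading beyond the end of the input yields 0.
\<close>

inductive exec :: "ram \<Rightarrow> config \<Rightarrow> nat \<Rightarrow> config \<Rightarrow> bool" where
  Const: "exec (Const i a) (r, xs, ys) 1 (r(i := a), xs, ys)"
| Add: "exec (Add i j k) (r, xs, ys)
    (1 + digits (r j) + digits (r k)) (r(i := r j + r k), xs, ys)"
| Sub: "exec (Sub i j k) (r, xs, ys)
    (1 + digits (r j) + digits (r k)) (r(i := r j - r k), xs, ys)"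
| Load: "exec (Load i j) (r, xs, ys)
    (1 + digits (r j) + digits (r (r j))) (r(i := r (r j)), xs, ys)"
| Store: "exec (Store i j) (r, xs, ys)
    (1 + digits (r i) + digits (r j)) (r(r i := r j), xs, ys)"
| Read: "exec (Read i) (r, x # xs, ys) (1 + digits x) (r(i := x), xs, ys)"
| Read_end: "exec (Read i) (r, [], ys) 1 (r(i := 0), [], ys)"
| Write: "exec (Write i) (r, xs, ys) (1 + digits (r i)) (r, xs, ys @ [r i])"
| Seq: "exec p s t s' \<Longrightarrow> exec q s' u s'' \<Longrightarrow> exec (Seq p q) s (t + u) s''"
| Cond_nonzero: "r i \<noteq> 0 \<Longrightarrow> exec p (r, xs, ys) t s' \<Longrightarrow>
    exec (Cond i p q) (r, xs, ys) (1 + digits (r i) + t) s'"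
| Cond_zero: "r i = 0 \<Longrightarrow> exec q (r, xs, ys) t s' \<Longrightarrow>
    exec (Cond i p q) (r, xs, ys) (1 + digits (r i) + t) s'"
| While_nonzero: "r i \<noteq> 0 \<Longrightarrow> exec p (r, xs, ys) t s' \<Longrightarrow> exec (While i p) s' u s'' \<Longrightarrow>
    exec (While i p) (r, xs, ys) (1 + digits (r i) + t + u) s''"
| While_zero: "r i = 0 \<Longrightarrow>
    exec (While i p) (r, xs, ys) (1 + digits (r i)) (r, xs, ys)"

lemma exec_deterministic:
  "exec p s t s' \<Longrightarrow> exec p s u s'' \<Longrightarrow> t = u \<and> s' = s''"
proof (induction arbitrary: u s'' rule: exec.induct)
  case Seq
  from Seq.prems show ?case by cases (use Seq.IH in blast)
next
  case Cond_nonzero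
  from Cond_nonzero.prems show ?case
    by cases (use Cond_nonzero.IH Cond_nonzero.hyps in blast)+
next
  case Cond_zero
  from Cond_zero.prems show ?case
    by cases (use Cond_zero.IH Cond_zero.hyps in blast)+
next
  case While_nonzero
  from While_nonzero.prems show ?case
    by cases (use While_nonzero.IH While_nonzero.hyps in blast)+
next
  case While_zero
  from While_zero.prems show ?case
    by cases (use While_zero.hyps in blast)+
qed (erule exec.cases; simp)+

text \<open>
  Length of a tape inscription: the binary digits of its entries, plus one separator each.
\<close>

definition tape_size :: "nat list \<Rightarrow> nat" where
  "tape_size xs = (\<Sum>x\<leftarrow>xs. 1 + digits x)"

definition polytime_computable ::
  "'a set \<Rightarrow> ('a \<Rightarrow> nat list) \<Rightarrow> ('b \<Rightarrow> nat list) \<Rightarrow> ('a \<Rightarrow> 'b) \<Rightarrow> bool" where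
  "polytime_computable D encode_in encode_out f \<longleftrightarrow>
    (\<exists>(p :: ram) (q :: nat poly). \<forall>x\<in>D. \<exists>t r xs.
        exec p (\<lambda>_. 0, encode_in x, []) t (r, xs, encode_out (f x))
        \<and> t \<le> poly q (tape_size (encode_in x)))"

section \<open>Perfect matchings\<close>

definition simple_graph :: "'v set \<Rightarrow> 'v set set \<Rightarrow> bool" where
  "simple_graph V E \<longleftrightarrow> finite V \<and> (\<forall>e\<in>E. e \<subseteq> V \<and> card e = 2)"

definition perfect_matching :: "'v set \<Rightarrow> 'v set set \<Rightarrow> 'v set set \<Rightarrow> bool" where
  "perfect_matching V E M \<longleftrightarrow> M \<subseteq> E \<and> (\<forall>v\<in>V. \<exists>!e. e \<in> M \<and> v \<in> e)"

definition PM :: "'v set \<Rightarrow> 'v set set \<Rightarrow> nat" where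
  "PM V E = card {M. perfect_matching V E M}"

section \<open>Spanning trees of multigraphs\<close>

text \<open>
  A multigraph is given by vertices \<open>V\<close>, edges \<open>E\<close> and a map \<open>ends\<close> taking an edge to the
  set of its endpoints. Parallel edges are different elements of \<open>E\<close> with the same endpoints.
\<close>

definition multigraph :: "'v set \<Rightarrow> 'e set \<Rightarrow> ('e \<Rightarrow> 'v set) \<Rightarrow> bool" where
  "multigraph V E ends \<longleftrightarrow>
    finite V \<and> finite E \<and> (\<forall>e\<in>E. ends e \<subseteq> V \<and> card (ends e) = 2)"

definition connected_by :: "'v set \<Rightarrow> ('e \<Rightarrow> 'v set) \<Rightarrow> 'e set \<Rightarrow> bool" where
  "connected_by V ends T \<longleftrightarrow>
    (\<forall>u\<in>V. \<forall>v\<in>V. (u, v) \<in> {(x, y). \<exists>e\<in>T. ends e = {x, y}}\<^sup>*)"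

text \<open>
  A cycle visits the distinct vertices \<open>vs\<close> along the distinct edges \<open>es\<close>; two parallel
  edges form a cycle of length 2.
\<close>

definition cycle_in :: "('e \<Rightarrow> 'v set) \<Rightarrow> 'e set \<Rightarrow> 'v list \<Rightarrow> 'e list \<Rightarrow> bool" where
  "cycle_in ends T vs es \<longleftrightarrow>
    es \<noteq> [] \<and> length vs = length es \<and> distinct vs \<and> distinct es \<and> set es \<subseteq> T \<and>
    (\<forall>i<length es. ends (es ! i) = {vs ! i, vs ! (Suc i mod length es)})"

text \<open>Spanning trees are identified with their edge sets.\<close>

definition spanning_tree :: "'v set \<Rightarrow> 'e set \<Rightarrow> ('e \<Rightarrow> 'v set) \<Rightarrow> 'e set \<Rightarrow> bool" where
  "spanning_tree V E ends T \<longleftrightarrow>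
    T \<subseteq> E \<and> connected_by V ends T \<and> (\<nexists>vs es. cycle_in ends T vs es)"

definition ST :: "'v set \<Rightarrow> 'e set \<Rightarrow> ('e \<Rightarrow> 'v set) \<Rightarrow> ('e \<Rightarrow> nat) \<Rightarrow> nat \<Rightarrow> nat" where
  "ST V E ends c C = card {T. spanning_tree V E ends T \<and> (\<Sum>e\<in>T. c e) = C}"

section \<open>Instances of the two problems\<close>

text \<open>
  An input \<open>(n, E)\<close> is the simple graph with vertices \<open>0, \<dots>, n - 1\<close> and edge set \<open>E\<close>,
  written on the tape as \<open>n\<close> followed by the rows of the adjacency matrix.
\<close>

type_synonym graph = "nat \<times> nat set set"

definition graphs :: "graph set" where
  "graphs = {(n, E). n \<ge> 1 \<and> simple_graph {..<n} E}"

fun encode_graph :: "graph \<Rightarrow> nat list" where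
  "encode_graph (n, E) =
    n # map (\<lambda>(u, v). if {u, v} \<in> E then 1 else 0) (List.product [0..<n] [0..<n])"

text \<open>
  An output \<open>(n, es, C)\<close> is a multigraph with vertices \<open>0, \<dots>, n - 1\<close> and costs, together with
  a value \<open>C\<close>. Its edges are the positions of the list \<open>es\<close>; an entry \<open>(u, v, k)\<close> is an
  edge between \<open>u\<close> and \<open>v\<close> of cost \<open>k\<close>.
\<close>

type_synonym st_instance = "nat \<times> (nat \<times> nat \<times> nat) list \<times> nat"

fun encode_st_instance :: "st_instance \<Rightarrow> nat list" where
  "encode_st_instance (n, es, C) =
    n # C # length es # concat (map (\<lambda>(u, v, k). [u, v, k]) es)"

definition edge_ends :: "(nat \<times> nat \<times> nat) list \<Rightarrow> nat \<Rightarrow> nat set" where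
  "edge_ends es i = (case es ! i of (u, v, k) \<Rightarrow> {u, v})"

definition edge_cost :: "(nat \<times> nat \<times> nat) list \<Rightarrow> nat \<Rightarrow> nat" where
  "edge_cost es i = (case es ! i of (u, v, k) \<Rightarrow> k)"

end

theory Submission
  imports Defs "HOL-Real_Asymp.Real_Asymp"
begin

text \<open>
  Write costs in base \<open>b = 64 n\<close>, one digit for each vertex, and let every digit of \<open>C\<close>
  be 5. An edge \<open>{u, v}\<close> of \<open>G\<close> with \<open>u < v\<close> contributes 2 to the digit of \<open>u\<close> and 5 to that of
  \<open>v\<close>; edges from 0 to \<open>v\<close> contribute 3 to the digit of \<open>v\<close>. There are too few edges for a carry,
  and 5 can only be obtained as 5 or as 2 + 3. Hence a set of edges of cost \<open>C\<close> consists of a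
  perfect matching of \<open>G\<close> together with one edge from 0 to the lower end of each matching edge that
  avoids 0. Such a set is automatically a spanning tree, since every vertex \<open>v > 0\<close> is the upper end
  of exactly one of its edges.

  The multiplicities of the edges at 0 have to give the same number
  \<open>2 (2n)\<^sup>k / n\<^sup>2 = 8 (2n)\<^sup>k\<^sup>-\<^sup>2\<close> of trees for each perfect matching, where \<open>n = 2k\<close>.
  So one of the \<open>k - 1\<close> lower ends other than 0 must be joined to 0 in 8 ways, and each of the others
  in \<open>2n\<close> ways. The special lower end is 1, or 2 if \<open>{0, 1}\<close> is in the matching; it is enforced by
  flagged edges from 0 to 1 and 2 that also contribute 3 to the digit of 0, which needs exactly one
  of them to reach 5. The case \<open>n = 2\<close> is treated separately, and if \<open>2 m < n\<close> there is no perfect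
  matching, so that an instance without edges can be used; otherwise \<open>b\<^sup>n = 2\<^bsup>O(m log m)\<^esup>\<close>.

  For the time bound it suffices to count the instructions executed, because a single instruction
  lengthens the largest value by at most one binary digit.
\<close>

section \<open>Counting instructions\<close>

text \<open>The transitions of \<open>exec\<close> at unit cost. Reading past the end of the input
  has no rule, so a derivation also shows that the input suffices.\<close>

inductive usteps :: "ram \<Rightarrow> config \<Rightarrow> nat \<Rightarrow> config \<Rightarrow> bool" where
  "usteps (Const i a) (r, xs, ys) 1 (r(i := a), xs, ys)"
| "usteps (Add i j k) (r, xs, ys) 1 (r(i := r j + r k), xs, ys)"
| "usteps (Sub i j k) (r, xs, ys) 1 (r(i := r j - r k), xs, ys)"
| "usteps (Load i j) (r, xs, ys) 1 (r(i := r (r j)), xs, ys)"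
| "usteps (Store i j) (r, xs, ys) 1 (r(r i := r j), xs, ys)"
| "usteps (Read i) (r, x # xs, ys) 1 (r(i := x), xs, ys)"
| "usteps (Write i) (r, xs, ys) 1 (r, xs, ys @ [r i])"
| "usteps p s t s' \<Longrightarrow> usteps q s' u s'' \<Longrightarrow> usteps (Seq p q) s (t + u) s''"
| "r i \<noteq> 0 \<Longrightarrow> usteps p (r, xs, ys) t s' \<Longrightarrow> usteps (Cond i p q) (r, xs, ys) (1 + t) s'"
| "r i = 0 \<Longrightarrow> usteps q (r, xs, ys) t s' \<Longrightarrow> usteps (Cond i p q) (r, xs, ys) (1 + t) s'"
| "r i \<noteq> 0 \<Longrightarrow> usteps p (r, xs, ys) t s' \<Longrightarrow> usteps (While i p) s' u s'' \<Longrightarrow>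
    usteps (While i p) (r, xs, ys) (1 + t + u) s''"
| "r i = 0 \<Longrightarrow> usteps (While i p) (r, xs, ys) 1 (r, xs, ys)"

fun constants_below :: "nat \<Rightarrow> ram \<Rightarrow> bool" where
  "constants_below b (Const i a) \<longleftrightarrow> a < b"
| "constants_below b (Seq p q) \<longleftrightarrow> constants_below b p \<and> constants_below b q"
| "constants_below b (Cond i p q) \<longleftrightarrow> constants_below b p \<and> constants_below b q"
| "constants_below b (While i p) \<longleftrightarrow> constants_below b p"
| "constants_below b _ \<longleftrightarrow> True"

text \<open>The output is left out because no instruction handles a value again once it is written
  there.\<close>

fun values_below :: "nat \<Rightarrow> config \<Rightarrow> bool" where
  "values_below b (r, xs, ys) \<longleftrightarrow> (\<forall>i. r i < b) \<and> (\<forall>x\<in>set xs. x < b)"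

lemma constants_below_mono: "constants_below a p \<Longrightarrow> a \<le> b \<Longrightarrow> constants_below b p"
  by (induction p) auto

lemma values_below_mono: "values_below a s \<Longrightarrow> a \<le> b \<Longrightarrow> values_below b s"
  by (cases s) (use order.strict_trans2 in fastforce)

lemma values_below_update:
  assumes "values_below (2 ^ d) (r, xs, ys)" "x < 2 ^ (d + 1)" "set xs' \<subseteq> set xs"
  shows "values_below (2 ^ (d + 1)) (r(i := x), xs', ys')"
proof -
  have *: "values_below (2 ^ (d + 1)) (r, xs, ys)"
    by (rule values_below_mono[OF assms(1)]) simp
  show ?thesis
    using assms(2,3) * by (simp del: power_Suc add: subset_iff)
qed

lemma less_double: "x < 2 ^ d \<Longrightarrow> x < (2 :: nat) ^ (d + 1)"
  by simp

lemma digits_le: "x < 2 ^ d \<Longrightarrow> digits x \<le> d"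
  by (simp add: floorlog_leI)

text \<open>Addition at most doubles the largest value and constants are bounded by hypothesis, so
  each step adds at most one bit. Hence values in a run of \<open>N\<close> steps have at most
  \<open>d + N\<close> digits, and an instruction is charged for at most two of them.\<close>

lemma exec_if_usteps:
  assumes "usteps p s N s'" "values_below (2 ^ d) s" "constants_below (2 ^ d) p"
  shows "\<exists>t. exec p s t s' \<and> t \<le> N * (1 + 2 * (d + N)) \<and> values_below (2 ^ (d + N)) s'"
  using assms
proof (induction arbitrary: d rule: usteps.induct)
  case (1 i a r xs ys)
  have "values_below (2 ^ (d + 1)) (r(i := a), xs, ys)"
    using 1 by (intro values_below_update[where xs = xs] less_double) auto
  then show ?case
    using exec.Const[of i a r xs ys] by (intro exI conjI) auto
next
  case (2 i j k r xs ys)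
  have b: "r j < 2 ^ d" "r k < 2 ^ d"
    using 2 by auto
  then have "r j + r k < 2 ^ (d + 1)"
    by simp
  then have "values_below (2 ^ (d + 1)) (r(i := r j + r k), xs, ys)"
    using 2 by (intro values_below_update[where xs = xs]) simp_all
  then show ?case
    using exec.Add[of i j k r xs ys] b[THEN digits_le] by (intro exI conjI) auto
next
  case (3 i j k r xs ys)
  have b: "r j < 2 ^ d" "r k < 2 ^ d"
    using 3 by auto
  then have "r j - r k < 2 ^ (d + 1)"
    by (intro less_double less_imp_diff_less)
  then have "values_below (2 ^ (d + 1)) (r(i := r j - r k), xs, ys)"
    using 3 by (intro values_below_update[where xs = xs]) simp_all
  then show ?case
    using exec.Sub[of i j k r xs ys] b[THEN digits_le] by (intro exI conjI) auto
next
  case (4 i j r xs ys)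
  have b: "r j < 2 ^ d" "r (r j) < 2 ^ d"
    using 4 by auto
  then have "values_below (2 ^ (d + 1)) (r(i := r (r j)), xs, ys)"
    using 4 b by (intro values_below_update[where xs = xs] less_double) auto
  then show ?case
    using exec.Load[of i j r xs ys] b[THEN digits_le] by (intro exI conjI) auto
next
  case (5 i j r xs ys)
  have b: "r i < 2 ^ d" "r j < 2 ^ d"
    using 5 by auto
  then have "values_below (2 ^ (d + 1)) (r(r i := r j), xs, ys)"
    using 5 b by (intro values_below_update[where xs = xs] less_double) auto
  then show ?case
    using exec.Store[of i j r xs ys] b[THEN digits_le] by (intro exI conjI) auto
next
  case (6 i r x xs ys)
  have b: "x < 2 ^ d"
    using 6 by auto
  then have "values_below (2 ^ (d + 1)) (r(i := x), xs, ys)"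
    using 6 b by (intro values_below_update[where xs = "x # xs"] less_double) auto
  then show ?case
    using exec.Read[of i r x xs ys] b[THEN digits_le] by (intro exI conjI) auto
next
  case (7 i r xs ys)
  have b: "r i < 2 ^ d"
    using 7 by auto
  then have "values_below (2 ^ (d + 1)) (r(i := r i), xs, ys @ [r i])"
    using 7 b by (intro values_below_update[where xs = xs] less_double) auto
  then show ?case
    using exec.Write[of i r xs ys] b[THEN digits_le] by (intro exI conjI) auto
next
  case (8 p s N s' q N' s'')
  obtain t where t: "exec p s t s'" "t \<le> N * (1 + 2 * (d + N))" "values_below (2 ^ (d + N)) s'"
    using 8(3)[OF 8(5)] 8(6) by auto
  have "constants_below (2 ^ (d + N)) q"
    using 8(6) by (auto elim!: constants_below_mono)
  then obtain u where u: "exec q s' u s''" "u \<le> N' * (1 + 2 * (d + N + N'))"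
      "values_below (2 ^ (d + N + N')) s''"
    using 8(4)[OF t(3)] by blast
  have "t \<le> N * (1 + 2 * (d + (N + N')))"
    using t(2) by (rule order_trans) (intro mult_le_mono, simp_all)
  then have "t + u \<le> (N + N') * (1 + 2 * (d + (N + N')))"
    using u(2) unfolding add_mult_distrib by (simp add: add.assoc)
  then show ?case
    using exec.Seq[OF t(1) u(1)] u(3) by (metis add.assoc)
next
  case (9 r i p xs ys N s' q)
  obtain t where t: "exec p (r, xs, ys) t s'" "t \<le> N * (1 + 2 * (d + N))"
      "values_below (2 ^ (d + N)) s'"
    using 9(3)[OF 9(4)] 9(5) by auto
  have "digits (r i) \<le> d"
    using 9 by (auto intro!: digits_le)
  then have "1 + digits (r i) + t \<le> (1 + N) * (1 + 2 * (d + (1 + N)))"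
    using t(2) by (simp add: algebra_simps)
  then show ?case
    using exec.Cond_nonzero[OF 9(1) t(1)] values_below_mono[OF t(3), of "2 ^ (d + (1 + N))"]
    by auto
next
  case (10 r i q xs ys N s' p)
  obtain t where t: "exec q (r, xs, ys) t s'" "t \<le> N * (1 + 2 * (d + N))"
      "values_below (2 ^ (d + N)) s'"
    using 10(3)[OF 10(4)] 10(5) by auto
  have "digits (r i) \<le> d"
    using 10 by (auto intro!: digits_le)
  then have "1 + digits (r i) + t \<le> (1 + N) * (1 + 2 * (d + (1 + N)))"
    using t(2) by (simp add: algebra_simps)
  then show ?case
    using exec.Cond_zero[OF 10(1) t(1)] values_below_mono[OF t(3), of "2 ^ (d + (1 + N))"]
    by auto
next
  case (11 r i p xs ys N s' N' s'')
  obtain t where t: "exec p (r, xs, ys) t s'" "t \<le> N * (1 + 2 * (d + N))"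
      "values_below (2 ^ (d + N)) s'"
    using 11(4)[OF 11(6)] 11(7) by auto
  have "constants_below (2 ^ (d + N)) (While i p)"
    using 11(7) by (auto elim!: constants_below_mono)
  then obtain u where u: "exec (While i p) s' u s''" "u \<le> N' * (1 + 2 * (d + N + N'))"
      "values_below (2 ^ (d + N + N')) s''"
    using 11(5)[OF t(3)] by blast
  have "digits (r i) \<le> d"
    using 11 by (auto intro!: digits_le)
  then have "1 + digits (r i) \<le> 1 * (1 + 2 * (d + (1 + N + N')))"
    by simp
  moreover have "t \<le> N * (1 + 2 * (d + (1 + N + N')))"
    using t(2) by (rule order_trans) (intro mult_le_mono, simp_all)
  moreover have "u \<le> N' * (1 + 2 * (d + (1 + N + N')))"
    using u(2) by (rule order_trans) (intro mult_le_mono, simp_all)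
  ultimately have "1 + digits (r i) + t + u \<le> (1 + N + N') * (1 + 2 * (d + (1 + N + N')))"
    unfolding add_mult_distrib by (intro add_mono)
  moreover have "values_below (2 ^ (d + (1 + N + N'))) s''"
    by (rule values_below_mono[OF u(3)]) (intro power_increasing, simp_all)
  ultimately show ?case
    using exec.While_nonzero[OF 11(1) t(1) u(1)] by blast
next
  case (12 r i p xs ys)
  have "values_below (2 ^ (d + 1)) (r, xs, ys)"
    by (rule values_below_mono[OF 12(2)]) simp
  then show ?case
    using exec.While_zero[of r i p xs ys] 12(1) by (auto simp: floorlog_def)
qed

section \<open>Total correctness with step counts\<close>

definition ok :: "ram \<Rightarrow> config \<Rightarrow> (nat \<Rightarrow> config \<Rightarrow> bool) \<Rightarrow> bool" where
  "ok p s Q \<longleftrightarrow> (\<exists>t s'. usteps p s t s' \<and> Q t s')"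

lemma ok_mono:
  assumes "ok p s Q" "\<And>t s'. Q t s' \<Longrightarrow> Q' t s'"
  shows "ok p s Q'"
  using assms unfolding ok_def by blast

inductive_simps usteps_simps:
  "usteps (Const i a) (r, xs, ys) t s"
  "usteps (Add i j k) (r, xs, ys) t s"
  "usteps (Sub i j k) (r, xs, ys) t s"
  "usteps (Load i j) (r, xs, ys) t s"
  "usteps (Store i j) (r, xs, ys) t s"
  "usteps (Read i) (r, x # xs, ys) t s"
  "usteps (Write i) (r, xs, ys) t s"
  "usteps (Seq p q) s0 t s"
  "usteps (Cond i p q) (r, xs, ys) t s"

text \<open>\<open>ok\<close> acts as a weakest precondition whose postcondition also receives the
  number of steps. Stated as equations, the rules let the simplifier execute straight-line code
  symbolically.\<close>

lemma ok_simps [simp]: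
  "ok (Const i a) (r, xs, ys) Q \<longleftrightarrow> Q 1 (r(i := a), xs, ys)"
  "ok (Add i j k) (r, xs, ys) Q \<longleftrightarrow> Q 1 (r(i := r j + r k), xs, ys)"
  "ok (Sub i j k) (r, xs, ys) Q \<longleftrightarrow> Q 1 (r(i := r j - r k), xs, ys)"
  "ok (Load i j) (r, xs, ys) Q \<longleftrightarrow> Q 1 (r(i := r (r j)), xs, ys)"
  "ok (Store i j) (r, xs, ys) Q \<longleftrightarrow> Q 1 (r(r i := r j), xs, ys)"
  "ok (Read i) (r, x # xs, ys) Q \<longleftrightarrow> Q 1 (r(i := x), xs, ys)"
  "ok (Write i) (r, xs, ys) Q \<longleftrightarrow> Q 1 (r, xs, ys @ [r i])"
  "ok (Seq p q) s Q \<longleftrightarrow> ok p s (\<lambda>t s'. ok q s' (\<lambda>u. Q (t + u)))"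
  "ok (Cond i p q) (r, xs, ys) Q \<longleftrightarrow>
    (if r i \<noteq> 0 then ok p (r, xs, ys) (\<lambda>t. Q (1 + t)) else ok q (r, xs, ys) (\<lambda>t. Q (1 + t)))"
  unfolding ok_def usteps_simps by (auto; metis)+

text \<open>The index of \<open>I\<close> is the exact number of iterations left, so the invariant
  also gives termination. The test costs one step in each iteration and one more at the
  exit.\<close>

lemma ok_While:
  assumes "\<And>j r xs ys. I (Suc j) (r, xs, ys) \<Longrightarrow> r c \<noteq> 0"
    and "\<And>j r xs ys. I (Suc j) (r, xs, ys) \<Longrightarrow> ok p (r, xs, ys) (\<lambda>t s'. t \<le> b \<and> I j s')"
    and "\<And>r xs ys. I 0 (r, xs, ys) \<Longrightarrow> r c = 0"
    and "I k s"
  shows "ok (While c p) s (\<lambda>t s'. t \<le> k * (b + 1) + 1 \<and> I 0 s')"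
  using assms(4)
proof (induction k arbitrary: s)
  case 0
  obtain r xs ys where s: "s = (r, xs, ys)"
    by (cases s)
  then show ?case
    using usteps.intros(12)[of r c p xs ys] assms(3) 0 unfolding ok_def by fastforce
next
  case (Suc k)
  obtain r xs ys where s: "s = (r, xs, ys)"
    by (cases s)
  obtain t s' where t: "usteps p s t s'" "t \<le> b" "I k s'"
    using assms(2)[of k r xs ys] Suc.prems unfolding s ok_def by auto
  obtain u s'' where u: "usteps (While c p) s' u s''" "u \<le> k * (b + 1) + 1" "I 0 s''"
    using Suc.IH[OF t(3)] unfolding ok_def by auto
  have "usteps (While c p) s (1 + t + u) s''"
    using assms(1) Suc.prems t(1) u(1) unfolding s by (intro usteps.intros(11)) auto
  moreover have "1 + t + u \<le> Suc k * (b + 1) + 1"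
    using t(2) u(2) by simp
  ultimately show ?case
    using u(3) unfolding ok_def by blast
qed

section \<open>A random access machine for the reduction\<close>

type_synonym edge = "nat \<times> nat \<times> nat"

definition flat :: "edge list \<Rightarrow> nat list" where
  "flat es = concat (map (\<lambda>(u, v, k). [u, v, k]) es)"

lemma flat_simps [simp]:
  "flat [] = []" "flat (es @ fs) = flat es @ flat fs" "flat [(u, v, k)] = [u, v, k]"
  "length (flat es) = 3 * length es"
  unfolding flat_def by (auto simp: length_concat comp_def case_prod_unfold sum_list_triv)

text \<open>Registers below 32 are variables, the edges found so far are stored from 32 on.\<close>

abbreviation (input) "zeroR \<equiv> 19 :: nat"
abbreviation (input) "oneR \<equiv> 18 :: nat"
abbreviation (input) "nR \<equiv> 2 :: nat"
abbreviation (input) "baseR \<equiv> 3 :: nat"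
abbreviation (input) "uR \<equiv> 4 :: nat"
abbreviation (input) "vR \<equiv> 5 :: nat"
abbreviation (input) "puR \<equiv> 6 :: nat"
abbreviation (input) "pvR \<equiv> 7 :: nat"
abbreviation (input) "sumR \<equiv> 8 :: nat"
abbreviation (input) "outerR \<equiv> 9 :: nat"
abbreviation (input) "innerR \<equiv> 10 :: nat"
abbreviation (input) "ptrR \<equiv> 11 :: nat"
abbreviation (input) "mR \<equiv> 12 :: nat"
abbreviation (input) "tmpR \<equiv> 13 :: nat"
abbreviation (input) "accR \<equiv> 14 :: nat"
abbreviation (input) "cntR \<equiv> 15 :: nat"
abbreviation (input) "costR \<equiv> 16 :: nat"
abbreviation (input) "lenR \<equiv> 17 :: nat"
abbreviation (input) heap :: nat where "heap \<equiv> 32"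

text \<open>Edges are collected in memory because their number precedes them on the output tape and
  is known only once the input has been read. \<open>lenR\<close> is kept beside \<open>ptrR\<close>
  to avoid a division by 3.\<close>

definition buffer :: "(nat \<Rightarrow> nat) \<Rightarrow> edge list \<Rightarrow> bool" where
  "buffer r es \<longleftrightarrow>
    r lenR = length es \<and> r ptrR = heap + 3 * length es \<and> map r [heap..<r ptrR] = flat es"

text \<open>A frame condition: \<open>X\<close> contains every register that a program fragment may
  have changed.\<close>

definition same_except :: "nat set \<Rightarrow> (nat \<Rightarrow> nat) \<Rightarrow> (nat \<Rightarrow> nat) \<Rightarrow> bool" where
  "same_except X r r' \<longleftrightarrow> (\<forall>i. i \<notin> X \<longrightarrow> r' i = r i)"

lemma buffer_cong:
  assumes "buffer r es" "same_except X r r'" "X \<inter> ({ptrR, lenR} \<union> {heap..}) = {}"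
  shows "buffer r' es"
proof -
  have "r' lenR = r lenR" "r' ptrR = r ptrR" "map r' [heap..<r ptrR] = map r [heap..<r ptrR]"
    using assms(2,3) unfolding same_except_def by auto
  then show ?thesis
    using assms(1) unfolding buffer_def by metis
qed

lemma buffer_upd [simp]:
  "i < heap \<Longrightarrow> i \<noteq> ptrR \<Longrightarrow> i \<noteq> lenR \<Longrightarrow> buffer (r(i := x)) es \<longleftrightarrow> buffer r es"
  unfolding buffer_def by simp

definition emit :: "nat \<Rightarrow> nat \<Rightarrow> nat \<Rightarrow> ram" where
  "emit a b c = Seq (Store ptrR a) (Seq (Add ptrR ptrR oneR)
    (Seq (Store ptrR b) (Seq (Add ptrR ptrR oneR)
    (Seq (Store ptrR c) (Seq (Add ptrR ptrR oneR) (Add lenR lenR oneR))))))"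

lemma ok_emit:
  assumes "buffer r es" "r oneR = 1" "{a, b, c} \<subseteq> {..<heap} - {ptrR, lenR}"
  shows "ok (emit a b c) (r, xs, ys) (\<lambda>t (r', xs', ys'). t = 7 \<and> xs' = xs \<and> ys' = ys \<and>
    buffer r' (es @ [(r a, r b, r c)]) \<and> same_except ({ptrR, lenR} \<union> {heap..}) r r')"
proof -
  have "[32..<35 + k] = [32..<32 + k] @ [32 + k, 33 + k, 34 + k]" for k :: nat
    using upt_add_eq_append[of 32 "32 + k" 3] by (simp add: upt_rec)
  then show ?thesis
    using assms unfolding emit_def buffer_def same_except_def by auto
qed

definition emits :: ram where
  "emits = While cntR (Seq (emit zeroR uR costR) (Sub cntR cntR oneR))"

lemma ok_emits:
  assumes "buffer r es" "r oneR = 1" "r zeroR = 0"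
  shows "ok emits (r, xs, ys) (\<lambda>t (r', xs', ys'). t \<le> r cntR * 9 + 1 \<and> xs' = xs \<and> ys' = ys \<and>
    buffer r' (es @ replicate (r cntR) (0, r uR, r costR)) \<and>
    same_except ({ptrR, lenR, cntR} \<union> {heap..}) r r')"
proof -
  define I where "I j s \<longleftrightarrow> (case s of (r', xs', ys') \<Rightarrow> xs' = xs \<and> ys' = ys \<and> r' cntR = j \<and>
     j \<le> r cntR \<and> buffer r' (es @ replicate (r cntR - j) (0, r uR, r costR)) \<and>
     same_except ({ptrR, lenR, cntR} \<union> {heap..}) r r')" for j s
  have "ok emits (r, xs, ys) (\<lambda>t s'. t \<le> r cntR * (8 + 1) + 1 \<and> I 0 s')"
    unfolding emits_def
  proof (rule ok_While)
    show "I (r cntR) (r, xs, ys)"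
      using assms unfolding I_def same_except_def by simp
  next
    fix j r1 xs1 ys1 assume I: "I (Suc j) (r1, xs1, ys1)"
    have eq: "r1 oneR = 1" "r1 zeroR = 0" "r1 uR = r uR" "r1 costR = r costR"
      using I assms by (simp_all add: I_def same_except_def)
    have b: "buffer r1 (es @ replicate (r cntR - Suc j) (0, r uR, r costR))"
      using I unfolding I_def by simp
    have rep: "replicate (r cntR - Suc j) x @ [x] = replicate (r cntR - j) x" for x :: edge
      using I unfolding I_def by (auto simp: Suc_diff_Suc replicate_append_same simp flip: replicate_Suc)
    show "ok (Seq (emit zeroR uR costR) (Sub cntR cntR oneR)) (r1, xs1, ys1)
      (\<lambda>t s'. t \<le> 8 \<and> I j s')"
      unfolding ok_simps
      by (rule ok_mono[OF ok_emit[OF b eq(1)]])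
        (use I eq in \<open>auto simp: I_def same_except_def rep\<close>)
  qed (auto simp: I_def)
  then show ?thesis
    by (rule ok_mono) (auto simp: I_def)
qed

text \<open>The machine has no multiplication instruction. Repeated addition is fast enough, since
  the multiplier is the base \<open>64 * n\<close> and not one of its powers.\<close>

definition mult :: "nat \<Rightarrow> ram" where
  "mult x = Seq (Const accR 0) (Seq (Add cntR baseR zeroR)
    (Seq (While cntR (Seq (Add accR accR x) (Sub cntR cntR oneR))) (Add x accR zeroR)))"

lemma ok_mult:
  assumes "r oneR = 1" "r zeroR = 0" "x \<notin> {accR, cntR, oneR, baseR, zeroR}"
  shows "ok (mult x) (r, xs, ys) (\<lambda>t (r', xs', ys'). t \<le> r baseR * 3 + 4 \<and> xs' = xs \<and> ys' = ys \<and>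
    r' x = r x * r baseR \<and> same_except {accR, cntR, x} r r')"
proof -
  define I where "I j s \<longleftrightarrow> (case s of (r', xs', ys') \<Rightarrow> xs' = xs \<and> ys' = ys \<and> r' cntR = j \<and>
     j \<le> r baseR \<and> r' accR = (r baseR - j) * r x \<and> same_except {accR, cntR} r r')" for j s
  have loop: "ok (While cntR (Seq (Add accR accR x) (Sub cntR cntR oneR)))
      (r(accR := 0, cntR := r baseR), xs, ys) (\<lambda>t s'. t \<le> r baseR * (2 + 1) + 1 \<and> I 0 s')"
  proof (rule ok_While)
    fix j r1 xs1 ys1 assume I: "I (Suc j) (r1, xs1, ys1)"
    have "r1 x = r x" "r1 oneR = 1"
      using I assms by (simp_all add: I_def same_except_def)
    moreover have "(r baseR - j) = Suc (r baseR - Suc j)"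
      using I unfolding I_def by (simp add: Suc_diff_Suc)
    ultimately show "ok (Seq (Add accR accR x) (Sub cntR cntR oneR)) (r1, xs1, ys1)
       (\<lambda>t s'. t \<le> 2 \<and> I j s')"
      using I by (auto simp: I_def same_except_def)
  qed (use assms in \<open>auto simp: I_def same_except_def\<close>)
  show ?thesis
    unfolding mult_def ok_simps
    apply (simp add: assms)
    apply (rule ok_mono[OF loop[simplified]])
    using assms by (auto simp: I_def same_except_def)
qed

text \<open>Vertex 1 gets flagged edges only: whenever 1 is a lower end, it is the special one.
  Vertex 2 gets both kinds, as its role depends on the matching.\<close>

definition star_edges :: "nat \<Rightarrow> nat \<Rightarrow> nat \<Rightarrow> edge list" where
  "star_edges b n u =
    (if u = 1 \<or> u = 2 then replicate 8 (0, u, 3 + 3 * b ^ u) else []) @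
    (if u \<ge> 2 then replicate (2 * n) (0, u, 3 * b ^ u) else [])"

text \<open>The separate bound \<open>k\<close> on the upper ends lets the list grow along the inner
  loop.\<close>

definition match_edges :: "nat \<Rightarrow> nat \<Rightarrow> nat set set \<Rightarrow> nat \<Rightarrow> edge list" where
  "match_edges b k E u =
    map (\<lambda>v. (u, v, 2 * b ^ u + 5 * b ^ v)) (filter (\<lambda>v. u < v \<and> {u, v} \<in> E) [0..<k])"

definition adj :: "nat set set \<Rightarrow> nat \<Rightarrow> nat \<Rightarrow> nat" where
  "adj E u v = (if {u, v} \<in> E then 1 else 0)"

text \<open>There is no empty instruction for an empty branch; storing 0 in the register that
  already holds 0 serves instead.\<close>

definition skip :: ram where
  "skip = Const zeroR 0"

text \<open>Comparisons are truncated subtractions: \<open>u\<close> and \<open>3 - u\<close> are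
  both nonzero iff \<open>u\<close> is 1 or 2, and \<open>u - 1\<close> is nonzero iff
  \<open>u\<close> is at least 2.\<close>

definition emit_star :: ram where
  "emit_star =
    Seq (Cond uR
      (Seq (Const tmpR 3) (Seq (Sub tmpR tmpR uR) (Cond tmpR
        (Seq (Const costR 3) (Seq (Add costR costR puR) (Seq (Add costR costR puR)
        (Seq (Add costR costR puR) (Seq (Const cntR 8) emits))))) skip))) skip)
    (Seq (Sub tmpR uR oneR) (Cond tmpR
      (Seq (Const costR 0) (Seq (Add costR costR puR) (Seq (Add costR costR puR)
        (Seq (Add costR costR puR) (Seq (Add cntR nR nR) emits))))) skip))"

lemma ok_emit_star:
  assumes "buffer r es" "r oneR = 1" "r zeroR = 0" "r nR = n" "r uR = u" "r puR = b ^ u"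
  shows "ok emit_star (r, xs, ys) (\<lambda>t (r', xs', ys'). t \<le> 18 * n + 100 \<and> xs' = xs \<and> ys' = ys \<and>
    buffer r' (es @ star_edges b n u) \<and>
    same_except ({ptrR, lenR, cntR, tmpR, costR} \<union> {heap..}) r r')"
proof -
  define F :: "edge list" where "F = (if u = 1 \<or> u = 2 then replicate 8 (0, u, 3 + 3 * b ^ u) else [])"
  let ?X = "{ptrR, lenR, cntR, tmpR, costR} \<union> {heap..}"
  have flagged: "ok (Cond uR
      (Seq (Const tmpR 3) (Seq (Sub tmpR tmpR uR) (Cond tmpR
        (Seq (Const costR 3) (Seq (Add costR costR puR) (Seq (Add costR costR puR)
        (Seq (Add costR costR puR) (Seq (Const cntR 8) emits))))) skip))) skip)
      (r, xs, ys) (\<lambda>t (r', xs', ys'). t \<le> 85 \<and> xs' = xs \<and> ys' = ys \<and>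
        buffer r' (es @ F) \<and> same_except ?X r r')"
  proof (cases "u = 1 \<or> u = 2")
    case True
    then have "u \<noteq> 0" "3 - u \<noteq> 0"
      by auto
    then show ?thesis
      using assms True unfolding ok_simps F_def
      apply simp
      apply (rule ok_mono[OF ok_emits[where es = es]]; auto simp: same_except_def eval_nat_numeral)
      done
  next
    case False
    then show ?thesis
      using assms by (auto simp: F_def skip_def same_except_def)
  qed
  have cost: "x + x + x = 3 * x" for x :: nat
    by simp
  have unflagged: "ok (Seq (Sub tmpR uR oneR) (Cond tmpR
      (Seq (Const costR 0) (Seq (Add costR costR puR) (Seq (Add costR costR puR)
        (Seq (Add costR costR puR) (Seq (Add cntR nR nR) emits))))) skip))
      (r', xs', ys') (\<lambda>t (r'', xs'', ys''). t \<le> 18 * n + 15 \<and> xs'' = xs \<and> ys'' = ys \<and>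
        buffer r'' (es @ star_edges b n u) \<and> same_except ?X r r'')"
    if "xs' = xs" "ys' = ys" "buffer r' (es @ F)" "same_except ?X r r'" for r' xs' ys'
  proof -
    have eq: "r' oneR = 1" "r' zeroR = 0" "r' nR = n" "r' uR = u" "r' puR = b ^ u"
      using assms that by (simp_all add: same_except_def)
    show ?thesis
    proof (cases "u \<ge> 2")
      case True
      then show ?thesis
        using that eq
        apply simp
        apply (rule ok_mono[OF ok_emits[where es = "es @ F"]]; auto simp: same_except_def star_edges_def F_def mult_2 cost)
        done
    next
      case False
      then show ?thesis
        using that eq by (auto simp: star_edges_def F_def skip_def same_except_def)
    qed
  qed
  show ?thesis
    \<comment> \<open>Only the outermost \<open>Seq\<close> is opened, so that both halves stay
      whole and match the two facts above.\<close>
    unfolding emit_star_def ok_simps(8)[of _ "Seq (Sub tmpR uR oneR) q" for q]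
    by (rule ok_mono[OF flagged], clarify, rule ok_mono[OF unflagged]) auto
qed

text \<open>The matrix lists every edge twice; \<open>v - u\<close> is nonzero only for the entry
  with \<open>u < v\<close>. The multiple \<open>5 * b ^ v\<close> is formed as two doublings plus
  one addition. The power in \<open>pvR\<close> advances whether or not an edge is found.\<close>

definition match_step :: ram where
  "match_step =
    Seq (Seq (Read tmpR) (Cond tmpR (Seq (Sub tmpR vR uR) (Cond tmpR
      (Seq (Add costR puR puR) (Seq (Add accR pvR pvR) (Seq (Add accR accR accR)
      (Seq (Add accR accR pvR) (Seq (Add costR costR accR)
      (Seq (Add mR mR oneR) (emit uR vR costR))))))) skip)) skip))
    (Seq (mult pvR) (Seq (Add vR vR oneR) (Sub innerR innerR oneR)))"

definition emit_match :: ram where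
  "emit_match = Seq (Const vR 0) (Seq (Const pvR 1) (Seq (Add innerR nR zeroR)
    (While innerR match_step)))"

lemma match_edges_Suc:
  "match_edges b (Suc k) E u = match_edges b k E u @
    (if u < k \<and> {u, k} \<in> E then [(u, k, 2 * b ^ u + 5 * b ^ k)] else [])"
  unfolding match_edges_def by simp

lemma ok_match_step:
  assumes "buffer r es" "r oneR = 1" "r zeroR = 0" "r baseR = b" "r uR = u" "r puR = b ^ u"
    "r vR = v" "r pvR = b ^ v"
  shows "ok match_step (r, adj E u v # xs, ys) (\<lambda>t (r', xs', ys').
    t \<le> 3 * b + 30 \<and> xs' = xs \<and> ys' = ys \<and>
    buffer r' (es @ (if u < v \<and> {u, v} \<in> E then [(u, v, 2 * b ^ u + 5 * b ^ v)] else [])) \<and>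
    r' mR = r mR + (if u < v \<and> {u, v} \<in> E then 1 else 0) \<and>
    r' vR = Suc v \<and> r' pvR = b ^ Suc v \<and> r' innerR = r innerR - 1 \<and>
    same_except ({vR, pvR, innerR, ptrR, mR, tmpR, accR, cntR, costR, lenR} \<union> {heap..}) r r')"
proof -
  define F :: "edge list" where "F = (if u < v \<and> {u, v} \<in> E then [(u, v, 2 * b ^ u + 5 * b ^ v)] else [])"
  let ?X = "{ptrR, mR, tmpR, accR, costR, lenR} \<union> {heap..}"
  have cost: "x + x + (y + y + (y + y) + y) = 2 * x + 5 * y" for x y :: nat
    by simp
  have edge: "ok (Seq (Read tmpR) (Cond tmpR (Seq (Sub tmpR vR uR) (Cond tmpR
      (Seq (Add costR puR puR) (Seq (Add accR pvR pvR) (Seq (Add accR accR accR)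
      (Seq (Add accR accR pvR) (Seq (Add costR costR accR)
      (Seq (Add mR mR oneR) (emit uR vR costR))))))) skip)) skip)) (r, adj E u v # xs, ys)
      (\<lambda>t (r', xs', ys'). t \<le> 20 \<and> xs' = xs \<and> ys' = ys \<and> buffer r' (es @ F) \<and>
        r' mR = r mR + (if u < v \<and> {u, v} \<in> E then 1 else 0) \<and> same_except ?X r r')"
  proof (cases "u < v \<and> {u, v} \<in> E")
    case True
    then show ?thesis
      using assms
      apply (simp add: adj_def)
      apply (rule ok_mono[OF ok_emit[where es = es]]; auto simp: same_except_def F_def cost)
      done
  next
    case False
    then show ?thesis
      using assms by (auto simp: F_def skip_def same_except_def adj_def)
  qed
  have advance: "ok (Seq (mult pvR) (Seq (Add vR vR oneR) (Sub innerR innerR oneR))) (r', xs', ys')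
      (\<lambda>t (r'', xs'', ys''). t \<le> 3 * b + 6 \<and> xs'' = xs \<and> ys'' = ys \<and> buffer r'' (es @ F) \<and>
        r'' mR = r mR + (if u < v \<and> {u, v} \<in> E then 1 else 0) \<and>
        r'' vR = Suc v \<and> r'' pvR = b ^ Suc v \<and> r'' innerR = r innerR - 1 \<and>
        same_except ({vR, pvR, innerR, ptrR, mR, tmpR, accR, cntR, costR, lenR} \<union> {heap..}) r r'')"
    if "xs' = xs" "ys' = ys" "buffer r' (es @ F)"
      "r' mR = r mR + (if u < v \<and> {u, v} \<in> E then 1 else 0)" "same_except ?X r r'" for r' xs' ys'
  proof -
    have eq: "r' oneR = 1" "r' zeroR = 0" "r' baseR = b" "r' vR = v" "r' pvR = b ^ v"
        "r' innerR = r innerR"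
      using assms that by (simp_all add: same_except_def)
    have buf: "buffer r'' (es @ F)" if "same_except {accR, cntR, pvR} r' r''" for r''
      using \<open>buffer r' (es @ F)\<close> that by (rule buffer_cong) auto
    show ?thesis
      unfolding ok_simps(8)
      apply (rule ok_mono[OF ok_mult])
      using eq buf that by (auto simp: same_except_def)
  qed
  show ?thesis
    unfolding match_step_def F_def[symmetric]
    by (subst ok_simps(8), rule ok_mono[OF edge], clarify, rule ok_mono[OF advance]) auto
qed

lemma ok_emit_match:
  assumes "buffer r es" "r oneR = 1" "r zeroR = 0" "r nR = n" "r baseR = b" "r uR = u"
    "r puR = b ^ u"
  shows "ok emit_match (r, map (adj E u) [0..<n] @ xs, ys) (\<lambda>t (r', xs', ys').
    t \<le> n * (3 * b + 31) + 4 \<and> xs' = xs \<and> ys' = ys \<and>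
    buffer r' (es @ match_edges b n E u) \<and> r' mR = r mR + length (match_edges b n E u) \<and>
    same_except ({vR, pvR, innerR, ptrR, mR, tmpR, accR, cntR, costR, lenR} \<union> {heap..}) r r')"
proof -
  let ?X = "{vR, pvR, innerR, ptrR, mR, tmpR, accR, cntR, costR, lenR} \<union> {heap..}"
  \<comment> \<open>With \<open>j\<close> columns left, the current column is \<open>n - j\<close>
    and the tape still holds the matrix entries from there on.\<close>
  define I where "I j s \<longleftrightarrow> (case s of (r', xs', ys') \<Rightarrow>
     xs' = map (adj E u) [n - j..<n] @ xs \<and> ys' = ys \<and> r' innerR = j \<and> j \<le> n \<and>
     r' vR = n - j \<and> r' pvR = b ^ (n - j) \<and> buffer r' (es @ match_edges b (n - j) E u) \<and>
     r' mR = r mR + length (match_edges b (n - j) E u) \<and> same_except ?X r r')" for j s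
  have loop: "ok (While innerR match_step)
      (r(vR := 0, pvR := 1, innerR := n), map (adj E u) [0..<n] @ xs, ys)
      (\<lambda>t s'. t \<le> n * (3 * b + 30 + 1) + 1 \<and> I 0 s')"
  proof (rule ok_While)
    show "I n (r(vR := 0, pvR := 1, innerR := n), map (adj E u) [0..<n] @ xs, ys)"
      using assms unfolding I_def same_except_def by (simp add: match_edges_def)
  next
    fix j r1 xs1 ys1 assume I: "I (Suc j) (r1, xs1, ys1)"
    define v where "v = n - Suc j"
    have v: "n - j = Suc v"
      using I by (auto simp: I_def v_def)
    have "xs1 = adj E u v # map (adj E u) [n - j..<n] @ xs"
      using I v by (auto simp: I_def v_def upt_conv_Cons)
    moreover have "ok match_step (r1, adj E u v # map (adj E u) [n - j..<n] @ xs, ys1)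
        (\<lambda>t s'. t \<le> 3 * b + 30 \<and> I j s')"
    proof (rule ok_mono[OF ok_match_step])
      show "buffer r1 (es @ match_edges b v E u)" "r1 oneR = 1" "r1 zeroR = 0" "r1 baseR = b"
          "r1 uR = u" "r1 puR = b ^ u" "r1 vR = v" "r1 pvR = b ^ v"
        using I assms by (simp_all add: I_def v_def same_except_def)
    qed (use I in \<open>auto simp: I_def v match_edges_Suc same_except_def v_def[symmetric]\<close>)
    ultimately show "ok match_step (r1, xs1, ys1) (\<lambda>t s'. t \<le> 3 * b + 30 \<and> I j s')"
      by simp
  qed (auto simp: I_def)
  show ?thesis
    unfolding emit_match_def
    apply (simp add: assms)
    apply (rule ok_mono[OF loop[simplified]])
    by (auto simp: I_def add.commute)
qed

section \<open>Rows of the gadget and the main loop\<close>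

definition gadget_row :: "nat \<Rightarrow> nat \<Rightarrow> nat set set \<Rightarrow> nat \<Rightarrow> edge list" where
  "gadget_row b n E u = star_edges b n u @ match_edges b n E u"

definition gadget :: "nat \<Rightarrow> nat \<Rightarrow> nat set set \<Rightarrow> nat \<Rightarrow> edge list" where
  "gadget b n E k = concat (map (gadget_row b n E) [0..<k])"

definition edge_count :: "nat \<Rightarrow> nat set set \<Rightarrow> nat \<Rightarrow> nat" where
  "edge_count n E k = (\<Sum>u<k. length (filter (\<lambda>v. u < v \<and> {u, v} \<in> E) [0..<n]))"

text \<open>\<open>sumR\<close> collects the powers of the base; five times the final value is
  \<open>C\<close>.\<close>

definition row_step :: ram where
  "row_step = Seq (Add sumR sumR puR) (Seq emit_star (Seq emit_match (Seq (mult puR)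
    (Seq (Add uR uR oneR) (Sub outerR outerR oneR)))))"

lemma ok_row_step:
  assumes "buffer r es" "r oneR = 1" "r zeroR = 0" "r nR = n" "r baseR = b" "r uR = u"
    "r puR = b ^ u"
  shows "ok row_step (r, map (adj E u) [0..<n] @ xs, ys) (\<lambda>t (r', xs', ys').
    t \<le> n * (3 * b + 50) + 3 * b + 120 \<and> xs' = xs \<and> ys' = ys \<and>
    buffer r' (es @ gadget_row b n E u) \<and>
    r' mR = r mR + length (filter (\<lambda>v. u < v \<and> {u, v} \<in> E) [0..<n]) \<and>
    r' uR = Suc u \<and> r' puR = b ^ Suc u \<and> r' outerR = r outerR - 1 \<and>
    r' sumR = r sumR + b ^ u \<and>
    r' oneR = 1 \<and> r' zeroR = 0 \<and> r' nR = n \<and> r' baseR = b)"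
proof -
  let ?xs = "map (adj E u) [0..<n] @ xs"
  let ?X = "{vR, pvR, innerR, ptrR, mR, tmpR, accR, cntR, costR, lenR, sumR} \<union> {heap..}"
  have match: "ok emit_match (r', ?xs, ys) (\<lambda>t (r', xs', ys').
      t \<le> n * (3 * b + 31) + 4 \<and> xs' = xs \<and> ys' = ys \<and>
      buffer r' (es @ gadget_row b n E u) \<and> r' mR = r mR + length (match_edges b n E u) \<and>
      r' sumR = r sumR + b ^ u \<and> same_except ?X r r')"
    if "buffer r' (es @ star_edges b n u)" "r' sumR = r sumR + b ^ u"
      "same_except ({ptrR, lenR, cntR, tmpR, costR, sumR} \<union> {heap..}) r r'" for r'
    apply (rule ok_mono[OF ok_emit_match[where es = "es @ star_edges b n u"]])
    using assms that by (auto simp: same_except_def gadget_row_def)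
  have rest: "ok (Seq (mult puR) (Seq (Add uR uR oneR) (Sub outerR outerR oneR))) (r', xs, ys)
      (\<lambda>t (r'', xs', ys'). t \<le> 3 * b + 6 \<and> xs' = xs \<and> ys' = ys \<and>
      buffer r'' (es @ gadget_row b n E u) \<and>
      r'' mR = r mR + length (filter (\<lambda>v. u < v \<and> {u, v} \<in> E) [0..<n]) \<and>
      r'' uR = Suc u \<and> r'' puR = b ^ Suc u \<and> r'' outerR = r outerR - 1 \<and>
      r'' sumR = r sumR + b ^ u \<and>
      r'' oneR = 1 \<and> r'' zeroR = 0 \<and> r'' nR = n \<and> r'' baseR = b)"
    if "buffer r' (es @ gadget_row b n E u)" "r' mR = r mR + length (match_edges b n E u)"
      "r' sumR = r sumR + b ^ u" "same_except ?X r r'" for r'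
  proof -
    have eq: "r' oneR = 1" "r' zeroR = 0" "r' baseR = b" "r' uR = u" "r' puR = b ^ u"
        "r' outerR = r outerR" "r' nR = n"
      using assms that by (simp_all add: same_except_def)
    have buf: "buffer r'' (es @ gadget_row b n E u)"
      if "same_except {accR, cntR, puR} r' r''" for r''
      using \<open>buffer r' (es @ gadget_row b n E u)\<close> that by (rule buffer_cong) auto
    show ?thesis
      unfolding ok_simps(8)
      apply (rule ok_mono[OF ok_mult])
      using eq buf that by (auto simp: same_except_def match_edges_def)
  qed
  have star: "ok emit_star (r(sumR := r sumR + b ^ u), ?xs, ys)
      (\<lambda>t (r', xs', ys'). t \<le> 18 * n + 100 \<and> xs' = ?xs \<and> ys' = ys \<and>
      buffer r' (es @ star_edges b n u) \<and> r' sumR = r sumR + b ^ u \<and>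
      same_except ({ptrR, lenR, cntR, tmpR, costR, sumR} \<union> {heap..}) r r')"
    apply (rule ok_mono[OF ok_emit_star])
    using assms by (auto simp: same_except_def)
  show ?thesis
    unfolding row_step_def
    apply (subst ok_simps(8), subst ok_simps(2), subst ok_simps(8), simp only: assms)
    apply (rule ok_mono[OF star], clarify, subst ok_simps(8))
    apply (rule ok_mono[OF match], assumption+, clarify)
    apply (rule ok_mono[OF rest], assumption+, clarify)
    apply (simp add: algebra_simps)
    done
qed

text \<open>One addition and five doublings turn \<open>n\<close> into the base
  \<open>64 * n\<close>. The registers \<open>zeroR\<close>, \<open>uR\<close>, \<open>sumR\<close>,
  \<open>mR\<close> and \<open>lenR\<close> get their initial value 0 from the starting
  configuration.\<close>

definition build :: ram where
  "build = Seq (Const oneR 1) (Seq (Read nR) (Seq (Add baseR nR nR) (Seq (Add baseR baseR baseR)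
    (Seq (Add baseR baseR baseR) (Seq (Add baseR baseR baseR) (Seq (Add baseR baseR baseR)
    (Seq (Add baseR baseR baseR) (Seq (Const ptrR heap) (Seq (Const puR 1)
    (Seq (Add outerR nR zeroR) (While outerR row_step)))))))))))"

lemma ok_build:
  fixes n :: nat and E :: "nat set set"
  defines "b \<equiv> 64 * n"
  shows "ok build (\<lambda>_. 0, encode_graph (n, E), []) (\<lambda>t (r, xs, ys).
    t \<le> n * (n * (3 * b + 50) + 3 * b + 121) + 12 \<and> xs = [] \<and> ys = [] \<and>
    buffer r (gadget b n E n) \<and> r sumR = (\<Sum>u<n. b ^ u) \<and> r mR = edge_count n E n \<and>
    r oneR = 1 \<and> r zeroR = 0 \<and> r nR = n)"
proof -
  define I where "I j s \<longleftrightarrow> (case s of (r, xs, ys) \<Rightarrow> j \<le> n \<and>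
     xs = concat (map (\<lambda>u. map (adj E u) [0..<n]) [n - j..<n]) \<and> ys = [] \<and> r outerR = j \<and>
     r uR = n - j \<and> r puR = b ^ (n - j) \<and> buffer r (gadget b n E (n - j)) \<and>
     r mR = edge_count n E (n - j) \<and> r sumR = (\<Sum>u<n - j. b ^ u) \<and>
     r oneR = 1 \<and> r zeroR = 0 \<and> r nR = n \<and> r baseR = b)" for j and s :: config
  define r0 :: "nat \<Rightarrow> nat" where
    "r0 = (\<lambda>_. 0)(oneR := 1, nR := n, baseR := b, ptrR := heap, puR := 1, outerR := n)"
  \<comment> \<open>The matrix is cut into rows, each of which is consumed by one execution of
    \<open>row_step\<close>.\<close>
  have input: "encode_graph (n, E) = n # concat (map (\<lambda>u. map (adj E u) [0..<n]) [0..<n])"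
    by (simp add: product_concat_map map_concat comp_def adj_def [abs_def])
  have loop: "ok (While outerR row_step) (r0, concat (map (\<lambda>u. map (adj E u) [0..<n]) [0..<n]), [])
      (\<lambda>t s'. t \<le> n * (n * (3 * b + 50) + 3 * b + 120 + 1) + 1 \<and> I 0 s')"
  proof (rule ok_While)
    show "I n (r0, concat (map (\<lambda>u. map (adj E u) [0..<n]) [0..<n]), [])"
      unfolding I_def r0_def buffer_def by (simp add: gadget_def edge_count_def)
  next
    fix j r1 xs1 ys1 assume I: "I (Suc j) (r1, xs1, ys1)"
    define u where "u = n - Suc j"
    have u: "n - j = Suc u"
      using I by (auto simp: I_def u_def)
    have "xs1 = map (adj E u) [0..<n] @ concat (map (\<lambda>u. map (adj E u) [0..<n]) [n - j..<n])"
      using I u by (auto simp: I_def u_def upt_conv_Cons)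
    moreover have "ok row_step (r1, map (adj E u) [0..<n] @
        concat (map (\<lambda>u. map (adj E u) [0..<n]) [n - j..<n]), ys1)
        (\<lambda>t s'. t \<le> n * (3 * b + 50) + 3 * b + 120 \<and> I j s')"
    proof (rule ok_mono[OF ok_row_step])
      show "buffer r1 (gadget b n E u)" "r1 oneR = 1" "r1 zeroR = 0" "r1 nR = n" "r1 baseR = b"
          "r1 uR = u" "r1 puR = b ^ u"
        using I by (simp_all add: I_def u_def)
    qed (use I in \<open>auto simp: I_def u gadget_def edge_count_def u_def[symmetric]\<close>)
    ultimately show "ok row_step (r1, xs1, ys1)
        (\<lambda>t s'. t \<le> n * (3 * b + 50) + 3 * b + 120 \<and> I j s')"
      by simp
  qed (auto simp: I_def)
  have loop': "ok (While outerR row_step)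
      (r, concat (map (\<lambda>u. map (adj E u) [0..<n]) [0..<n]), [])
      (\<lambda>t s'. t \<le> n * (n * (3 * b + 50) + 3 * b + 121) + 1 \<and> I 0 s')" if "r = r0" for r
    using loop that by (simp add: ac_simps)
  show ?thesis
    unfolding build_def input
    apply (simp del: encode_graph.simps)
    apply (rule ok_mono[OF loop'])
     apply (simp add: r0_def b_def)
    apply (auto simp: I_def)
    done
qed

section \<open>Writing the output\<close>

definition dump :: ram where
  "dump = Seq (Const costR heap) (Seq (Sub cntR ptrR costR)
    (While cntR (Seq (Load tmpR costR) (Seq (Write tmpR) (Seq (Add costR costR oneR)
      (Sub cntR cntR oneR))))))"

lemma ok_dump:
  assumes "buffer r es" "r oneR = 1"
  shows "ok dump (r, xs, ys) (\<lambda>t (r', xs', ys'). t \<le> 15 * length es + 3 \<and> ys' = ys @ flat es)"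
proof -
  define I where "I j s \<longleftrightarrow> (case s of (r', xs', ys') \<Rightarrow>
     j \<le> 3 * length es \<and> ys' = ys @ take (3 * length es - j) (flat es) \<and>
     r' cntR = j \<and> r' costR = heap + (3 * length es - j) \<and>
     same_except {tmpR, costR, cntR} r r')"
    for j and s :: config
  have nth: "r (heap + i) = flat es ! i" if "i < 3 * length es" for i
  proof -
    have "map r [heap..<heap + 3 * length es] = flat es"
      using assms(1) unfolding buffer_def by metis
    then show ?thesis
      using that by (metis add_diff_cancel_left' length_map length_upt nth_map nth_upt
          add_less_cancel_left)
  qed
  have loop: "ok (While cntR (Seq (Load tmpR costR) (Seq (Write tmpR) (Seq (Add costR costR oneR)
      (Sub cntR cntR oneR))))) (r(costR := heap, cntR := 3 * length es), xs, ys)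
      (\<lambda>t s'. t \<le> 3 * length es * (4 + 1) + 1 \<and> I 0 s')"
  proof (rule ok_While)
    fix j r1 xs1 ys1 assume I: "I (Suc j) (r1, xs1, ys1)"
    define i where "i = 3 * length es - Suc j"
    have i: "3 * length es - j = Suc i" "i < 3 * length es"
      using I by (auto simp: I_def i_def)
    have "r1 (heap + i) = flat es ! i"
      using I i nth by (simp add: I_def same_except_def)
    moreover have "take (Suc i) (flat es) = take i (flat es) @ [flat es ! i]"
      using i by (simp add: take_Suc_conv_app_nth)
    moreover have "r1 oneR = 1"
      using I assms by (simp add: I_def same_except_def)
    ultimately show "ok (Seq (Load tmpR costR) (Seq (Write tmpR) (Seq (Add costR costR oneR)
      (Sub cntR cntR oneR)))) (r1, xs1, ys1) (\<lambda>t s'. t \<le> 4 \<and> I j s')"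
      using I by (auto simp: I_def i i_def[symmetric] same_except_def)
  qed (auto simp: I_def same_except_def)
  have "r ptrR = heap + 3 * length es"
    using assms unfolding buffer_def by simp
  then show ?thesis
    unfolding dump_def
    apply simp
    apply (rule ok_mono[OF loop[simplified]])
    by (auto simp: I_def)
qed

definition writes :: "nat list \<Rightarrow> ram" where
  "writes ks = foldr (\<lambda>k p. Seq (Const tmpR k) (Seq (Write tmpR) p)) ks skip"

lemma ok_writes:
  "ok (writes ks) (r, xs, ys) (\<lambda>t (r', xs', ys'). t = 2 * length ks + 1 \<and> ys' = ys @ ks)"
proof (induction ks arbitrary: r ys)
  case (Cons k ks)
  have "writes (k # ks) = Seq (Const tmpR k) (Seq (Write tmpR) (writes ks))"
    unfolding writes_def by simp
  then show ?case
    by (simp, intro ok_mono[OF Cons]) auto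
qed (simp add: writes_def skip_def)

text \<open>The tests are again truncated subtractions: \<open>n - 2 * m\<close> is nonzero iff
  there are too few edges, and \<open>n - 2\<close> iff the gadget is used. The two constant lists
  are the encodings of the exceptional instances after their first entry \<open>n\<close>.\<close>

definition finish :: ram where
  "finish = Seq (Add accR mR mR) (Seq (Sub tmpR nR accR) (Cond tmpR
    (Seq (Write nR) (writes [1, 0]))
    (Seq (Const tmpR 2) (Seq (Sub tmpR nR tmpR) (Cond tmpR
      (Seq (Write nR) (Seq (Add accR sumR sumR) (Seq (Add accR accR accR) (Seq (Add accR accR sumR)
        (Seq (Write accR) (Seq (Write lenR) dump))))))
      (Seq (Write nR) (writes [0, 2, 0, 1, 0, 0, 1, 0])))))))"

text \<open>The instance without edges asks for cost 1 and not 0, because for \<open>n = 1\<close>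
  the empty set is a spanning tree of cost 0. On graphs the second case only arises for
  \<open>n = 2\<close>, where alpha is 1/2 and two trees are needed.\<close>

definition reduction :: "graph \<Rightarrow> st_instance" where
  "reduction = (\<lambda>(n, E).
    if 2 * edge_count n E n < n then (n, [], 1)
    else if n \<le> 2 then (n, [(0, 1, 0), (0, 1, 0)], 0)
    else (n, gadget (64 * n) n E n, 5 * (\<Sum>u<n. (64 * n) ^ u)))"

lemma encode_flat: "encode_st_instance (n, es, C) = n # C # length es # flat es"
  unfolding flat_def by simp

lemma ok_finish:
  assumes "buffer r (gadget (64 * n) n E n)" "r oneR = 1" "r sumR = (\<Sum>u<n. (64 * n) ^ u)"
    "r mR = edge_count n E n" "r nR = n"
  shows "ok finish (r, [], []) (\<lambda>t (r', xs', ys').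
    t \<le> 15 * length (gadget (64 * n) n E n) + 30 \<and> ys' = encode_st_instance (reduction (n, E)))"
proof -
  have len: "r lenR = length (gadget (64 * n) n E n)"
    using assms unfolding buffer_def by simp
  have five: "x + x + (x + x) + x = 5 * x" for x :: nat
    by simp
  consider "2 * edge_count n E n < n" | "2 * edge_count n E n \<ge> n" "n \<le> 2"
    | "2 * edge_count n E n \<ge> n" "n > 2"
    by linarith
  then show ?thesis
  proof cases
    case 1
    then show ?thesis
      unfolding finish_def
      apply (simp add: assms)
      apply (rule ok_mono[OF ok_writes])
      apply (auto simp: reduction_def)
      done
  next
    case 2
    then show ?thesis
      unfolding finish_def
      apply (simp add: assms)
      apply (rule ok_mono[OF ok_writes])
      apply (auto simp: reduction_def)
      done
  next
    case 3
    then show ?thesis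
      unfolding finish_def
      apply (simp add: assms len)
      apply (rule ok_mono[OF ok_dump])
      using assms apply (auto simp: reduction_def encode_flat five simp del: encode_st_instance.simps)
      done
  qed
qed

section \<open>Size of the gadget and polynomial running time\<close>

lemma length_gadget_row: "length (gadget_row b n E u) \<le> 3 * n + 8"
proof -
  have "length (filter (\<lambda>v. u < v \<and> {u, v} \<in> E) [0..<n]) \<le> n"
    using length_filter_le[of _ "[0..<n]"] by simp
  then show ?thesis
    unfolding gadget_row_def star_edges_def match_edges_def by auto
qed

lemma length_gadget: "length (gadget b n E k) \<le> k * (3 * n + 8)"
proof (induction k)
  case (Suc k)
  then show ?case
    using length_gadget_row[of b n E k] by (simp add: gadget_def)
qed (simp add: gadget_def)

lemma less_two_power_digits: "x < 2 ^ digits x"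
  by (cases "x = 0") (use floorlog_bounds[of x 2] in auto)

lemma tape_size_ge: "length xs \<le> tape_size xs" "x \<in> set xs \<Longrightarrow> digits x \<le> tape_size xs"
  unfolding tape_size_def by (induction xs) auto

lemma reduction_polytime: "polytime_computable D encode_graph encode_st_instance reduction"
proof -
  define p where "p = Seq build finish"
  \<comment> \<open>\<open>N\<close> bounds the number of instructions by a cubic polynomial in the
    tape size \<open>z\<close>; \<open>q\<close> is the resulting cost bound of
    \<open>exec_if_usteps\<close> for \<open>d = 6 + z\<close>.\<close>
  define N :: "nat poly" where "N = [:1000:] * [:1, 1:] ^ 3"
  define q :: "nat poly" where "q = N * (1 + 2 * ([:6, 1:] + N))"
  \<comment> \<open>The largest constant is \<open>heap\<close>, that is 32, which lies below
    \<open>2 ^ 6\<close>.\<close>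
  have const: "constants_below (2 ^ 6) p"
    unfolding p_def build_def row_step_def emit_star_def emit_match_def match_step_def emits_def
      emit_def mult_def skip_def finish_def dump_def writes_def by simp
  have "\<exists>t r xs. exec p (\<lambda>_. 0, encode_graph (n, E), []) t
      (r, xs, encode_st_instance (reduction (n, E))) \<and>
      t \<le> poly q (tape_size (encode_graph (n, E)))" for n E
  proof -
    let ?w = "encode_graph (n, E)"
    let ?s = "(\<lambda>_. 0, ?w, []) :: config"
    define l where "l = length (gadget (64 * n) n E n)"
    define z where "z = tape_size ?w"
    have l: "l \<le> n * (3 * n + 8)"
      unfolding l_def by (rule length_gadget)
    have "ok p ?s (\<lambda>t (r, xs, ys).
        t \<le> n * (n * (3 * (64 * n) + 50) + 3 * (64 * n) + 121) + 12 + (15 * l + 30) \<and>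
        ys = encode_st_instance (reduction (n, E)))"
      unfolding p_def ok_simps l_def
      apply (rule ok_mono[OF ok_build], clarify)
      apply (rule ok_mono[OF ok_finish])
           apply assumption+
      apply (auto simp del: encode_st_instance.simps)
      done
    then obtain k r xs where k: "usteps p ?s k (r, xs, encode_st_instance (reduction (n, E)))"
        "k \<le> n * (n * (3 * (64 * n) + 50) + 3 * (64 * n) + 121) + 12 + (15 * l + 30)"
      unfolding ok_def by auto
    \<comment> \<open>The matrix alone occupies \<open>n * n\<close> squares, so \<open>n\<close> is
      bounded by the tape size although it is written in binary.\<close>
    have "n \<le> n * n + 1"
      by (cases n) auto
    also have "\<dots> = length ?w"
      by simp
    also have "\<dots> \<le> z"
      unfolding z_def by (rule tape_size_ge)
    finally have "n \<le> z" .
    have "k \<le> 1000 * (n + 1) ^ 3"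
      using k(2) l by (simp add: power3_eq_cube algebra_simps)
    also have "\<dots> \<le> 1000 * (z + 1) ^ 3"
      using \<open>n \<le> z\<close> by (intro mult_le_mono power_mono) auto
    also have "\<dots> = poly N z"
      unfolding N_def by (simp add: add.commute)
    finally have "k \<le> poly N z" .
    have "x < 2 ^ (6 + z)" if "x \<in> set ?w" for x
    proof -
      have "x < 2 ^ digits x"
        by (rule less_two_power_digits)
      also have "\<dots> \<le> 2 ^ (6 + z)"
        using tape_size_ge(2)[OF that] unfolding z_def by (intro power_increasing) auto
      finally show ?thesis .
    qed
    then have "values_below (2 ^ (6 + z)) ?s"
      by (simp del: encode_graph.simps)
    moreover have "constants_below (2 ^ (6 + z)) p"
      using const by (rule constants_below_mono) (intro power_increasing, simp_all)
    ultimately obtain t where t: "exec p ?s t (r, xs, encode_st_instance (reduction (n, E)))"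
        "t \<le> k * (1 + 2 * (6 + z + k))"
      using exec_if_usteps[OF k(1)] by blast
    have "t \<le> poly N z * (1 + 2 * (6 + z + poly N z))"
      using t(2) by (rule order_trans) (intro mult_le_mono add_le_mono order_refl \<open>k \<le> poly N z\<close>)
    also have "\<dots> = poly q z"
      unfolding q_def by (simp del: power_Suc)
    finally show ?thesis
      using t(1) unfolding z_def by blast
  qed
  then show ?thesis
    unfolding polytime_computable_def by (metis surj_pair)
qed

section \<open>Sums, selections and spanning trees\<close>

lemma base_sum_less:
  fixes d :: "nat \<Rightarrow> nat"
  assumes "\<And>w. w < n \<Longrightarrow> d w < b"
  shows "(\<Sum>w<n. d w * b ^ w) < b ^ n"
  using assms
proof (induction n)
  case (Suc n)
  have "(\<Sum>w<n. d w * b ^ w) < b ^ n"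
    using Suc by simp
  moreover have "Suc (d n) * b ^ n \<le> b * b ^ n"
    using Suc.prems[of n] by (intro mult_le_mono) auto
  ultimately show ?case
    by simp
qed simp

text \<open>The lower digits contribute less than \<open>b ^ n\<close>, so division by
  \<open>b ^ n\<close> isolates the top digit; the others follow by induction.\<close>

lemma base_digits_unique:
  fixes d e :: "nat \<Rightarrow> nat"
  assumes "\<And>w. w < n \<Longrightarrow> d w < b" "\<And>w. w < n \<Longrightarrow> e w < b"
    and "(\<Sum>w<n. d w * b ^ w) = (\<Sum>w<n. e w * b ^ w)" "w < n"
  shows "d w = e w"
  using assms
proof (induction n)
  case (Suc n)
  let ?D = "\<Sum>w<n. d w * b ^ w" and ?E = "\<Sum>w<n. e w * b ^ w"
  have eq: "?D + d n * b ^ n = ?E + e n * b ^ n"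
    using Suc.prems(3) by simp
  have "?D < b ^ n" "?E < b ^ n"
    using Suc.prems(1,2) by (auto intro!: base_sum_less)
  moreover have "(x + c * k) div k = c" if "x < k" for x c k :: nat
    using that by (cases "k = 0") auto
  ultimately have "(?D + d n * b ^ n) div b ^ n = d n" "(?E + e n * b ^ n) div b ^ n = e n"
    by blast+
  then have "d n = e n"
    using eq by simp
  moreover from this have "?D = ?E"
    using eq by simp
  ultimately show ?case
    using Suc by (cases "w = n") auto
qed simp

text \<open>The only ways to reach 5 are a single 5, or one 2 and one 3. This is split into
  statements about one or two elements, which carry over from positions to labels directly.\<close>

lemma sum_eq_five:
  fixes f :: "'a \<Rightarrow> nat"
  assumes "finite T" "\<And>i. i \<in> T \<Longrightarrow> f i \<in> {0, 2, 3, 5}" "sum f T = 5"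
  shows "\<And>i j. i \<in> T \<Longrightarrow> j \<in> T \<Longrightarrow> f i \<noteq> 0 \<Longrightarrow> f i = f j \<Longrightarrow> i = j"
    and "\<And>i j. i \<in> T \<Longrightarrow> j \<in> T \<Longrightarrow> f i = 5 \<Longrightarrow> f j \<noteq> 0 \<Longrightarrow> i = j"
    and "\<And>i. i \<in> T \<Longrightarrow> f i = 2 \<Longrightarrow> \<exists>j\<in>T. f j = 3"
    and "\<And>i. i \<in> T \<Longrightarrow> f i = 3 \<Longrightarrow> \<exists>j\<in>T. f j = 2"
    and "\<exists>i\<in>T. f i = 5 \<or> f i = 2"
proof -
  have two: "sum f T = f i + f j + sum f (T - {i} - {j})" if "i \<in> T" "j \<in> T" "i \<noteq> j" for i j
    using that assms(1) by (simp add: sum.remove[of T i] sum.remove[of "T - {i}" j])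
  have three: "f i + f j + f k \<le> 5"
    if "i \<in> T" "j \<in> T" "k \<in> T" "i \<noteq> j" "i \<noteq> k" "j \<noteq> k" for i j k
    using two[OF that(1,2,4)] that assms(1,3)
    by (simp add: sum.remove[of "T - {i} - {j}" k])
  have rest: "\<exists>j\<in>T. j \<noteq> i \<and> f j \<noteq> 0" if "i \<in> T" "f i \<noteq> 5" for i
  proof (rule ccontr)
    assume "\<not> ?thesis"
    then have "sum f (T - {i}) = 0"
      by (intro sum.neutral) auto
    then show False
      using that assms(1,3) by (simp add: sum.remove[of T i])
  qed
  have le: "f i + f j \<le> 5" if "i \<in> T" "j \<in> T" "i \<noteq> j" for i j
    using two[OF that] assms(3) by simp
  \<comment> \<open>Two 2s would leave a remainder of 1, which no admissible value can supply.
    Repeated 3s or 5s already exceed the total.\<close>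
  have "f i \<noteq> 2" if ij: "i \<in> T" "j \<in> T" "i \<noteq> j" "f j = 2" for i j
  proof
    assume "f i = 2"
    then have "sum f (T - {i} - {j}) = 1"
      using two[OF ij(1-3)] ij assms(3) by simp
    then have "\<exists>k\<in>T - {i} - {j}. f k \<noteq> 0"
      by (metis sum.neutral zero_neq_one)
    then obtain k where k: "k \<in> T - {i} - {j}" "f k \<noteq> 0"
      by blast
    have "f k \<le> sum f (T - {i} - {j})"
      using assms(1) k by (intro member_le_sum) auto
    then show False
      using k assms(2)[of k] \<open>sum f (T - {i} - {j}) = 1\<close> by auto
  qed
  then show *: "i = j" if "i \<in> T" "j \<in> T" "f i \<noteq> 0" "f i = f j" for i j
    using that le[of i j] assms(2)[of i] by fastforce
  show **: "i = j" if "i \<in> T" "j \<in> T" "f i = 5" "f j \<noteq> 0" for i j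
    using that le[of i j] by fastforce
  show "\<exists>j\<in>T. f j = 3" if i: "i \<in> T" "f i = 2" for i
  proof -
    obtain j where j: "j \<in> T" "j \<noteq> i" "f j \<noteq> 0"
      using rest[of i] i by auto
    then have "f j \<noteq> 2" "f j \<noteq> 5"
      using *[of j i] **[of j i] i by auto
    then show ?thesis
      using assms(2)[OF j(1)] j by auto
  qed
  show "\<exists>j\<in>T. f j = 2" if i: "i \<in> T" "f i = 3" for i
  proof -
    obtain j where j: "j \<in> T" "j \<noteq> i" "f j \<noteq> 0"
      using rest[of i] i by auto
    then have "f j \<noteq> 3" "f j \<noteq> 5"
      using *[of j i] **[of j i] i by auto
    then show ?thesis
      using assms(2)[OF j(1)] j by auto
  qed
  moreover obtain i where "i \<in> T" "f i \<noteq> 0"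
    using assms(3) by (metis sum.neutral zero_neq_numeral)
  ultimately show "\<exists>i\<in>T. f i = 5 \<or> f i = 2"
    using assms(2)[of i] by auto
qed

text \<open>Such a \<open>T\<close> consists of one element from the fibre of each \<open>x\<close>
  in \<open>D\<close>, chosen independently. The induction splits off the element over the new
  point. Here \<open>g\<close> will map positions of edges to their labels, so that fibres are
  classes of parallel copies.\<close>

lemma card_injective_selections:
  assumes "finite I" "finite D"
  shows "card {T. T \<subseteq> I \<and> inj_on g T \<and> g ` T = D} = (\<Prod>x\<in>D. card {i \<in> I. g i = x})"
  using assms(2)
proof (induction D)
  case empty
  have "{T. T \<subseteq> I \<and> inj_on g T \<and> g ` T = {}} = {{}}"
    by auto
  then show ?case
    by simp
next
  case (insert x D)
  let ?S = "\<lambda>D. {T. T \<subseteq> I \<and> inj_on g T \<and> g ` T = D}" and ?X = "{i \<in> I. g i = x}"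
  have "bij_betw (\<lambda>(i, T). insert i T) (?X \<times> ?S D) (?S (insert x D))"
  proof (rule bij_betw_byWitness[where f' = "\<lambda>T. (the_elem {i \<in> T. g i = x}, {i \<in> T. g i \<noteq> x})"])
    have *: "{i' \<in> insert i T. g i' = x} = {i}" if "g i = x" "g ` T = D" for i T
      using that insert.hyps(2) by (auto, metis imageI)
    have **: "{i' \<in> insert i T. g i' \<noteq> x} = T" if "g i = x" "g ` T = D" for i T
      using that insert.hyps(2) by (auto, metis imageI)
    show "\<forall>a\<in>?X \<times> ?S D. (\<lambda>T. (the_elem {i \<in> T. g i = x}, {i \<in> T. g i \<noteq> x}))
        ((\<lambda>(i, T). insert i T) a) = a"
      by (clarsimp simp del: insert_iff simp add: * **)
    have elem: "\<exists>i\<in>T. {i \<in> T. g i = x} = {i}" if T: "inj_on g T" "g ` T = insert x D" for T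
    proof -
      obtain i where "i \<in> T" "g i = x"
        using T(2) by (metis imageE insertI1)
      then have "{i \<in> T. g i = x} = {i}"
        using T(1) by (auto dest: inj_onD)
      then show ?thesis
        using \<open>i \<in> T\<close> by blast
    qed
    show "\<forall>T\<in>?S (insert x D). (\<lambda>(i, T). insert i T)
        (the_elem {i \<in> T. g i = x}, {i \<in> T. g i \<noteq> x}) = T"
    proof
      fix T assume "T \<in> ?S (insert x D)"
      then have "\<exists>i\<in>T. {i \<in> T. g i = x} = {i}"
        by (intro elem) simp_all
      then obtain i where i: "{i \<in> T. g i = x} = {i}"
        by (rule bexE)
      have "insert i {i \<in> T. g i \<noteq> x} = T"
        using i by blast
      then show "(\<lambda>(i, T). insert i T) (the_elem {i \<in> T. g i = x}, {i \<in> T. g i \<noteq> x}) = T"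
        by (simp only: case_prod_conv i the_elem_eq)
    qed
    have "insert i T \<in> ?S (insert x D)" if h: "i \<in> ?X" "T \<in> ?S D" for i T
    proof -
      have "g i \<notin> g ` (T - {i})"
        using h insert.hyps(2) by blast
      then show ?thesis
        using h by (simp add: inj_on_insert)
    qed
    then show "(\<lambda>(i, T). insert i T) ` (?X \<times> ?S D) \<subseteq> ?S (insert x D)"
      by (intro image_subsetI) (simp only: mem_Times_iff case_prod_beta)
    show "(\<lambda>T. (the_elem {i \<in> T. g i = x}, {i \<in> T. g i \<noteq> x})) ` ?S (insert x D) \<subseteq> ?X \<times> ?S D"
    proof (intro image_subsetI)
      fix T assume T: "T \<in> ?S (insert x D)"
      then have "\<exists>i\<in>T. {i \<in> T. g i = x} = {i}"
        by (intro elem) simp_all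
      then obtain i where i: "{i \<in> T. g i = x} = {i}"
        by (rule bexE)
      have "g ` {i \<in> T. g i \<noteq> x} = D"
        using T insert.hyps(2) by auto
      moreover have "i \<in> ?X"
        using T i by blast
      moreover have "inj_on g {i \<in> T. g i \<noteq> x}" "{i \<in> T. g i \<noteq> x} \<subseteq> I"
        using T by (auto intro: inj_on_subset)
      ultimately show "(the_elem {i \<in> T. g i = x}, {i \<in> T. g i \<noteq> x}) \<in> ?X \<times> ?S D"
        unfolding i the_elem_eq by simp
    qed
  qed
  from bij_betw_same_card[OF this] have "card (?S (insert x D)) = card ?X * card (?S D)"
    by (simp only: card_cartesian_product)
  then show ?case
    unfolding prod.insert[OF insert.hyps] insert.IH .
qed

text \<open>Descending along the edge to a smaller neighbour reaches 0 from every vertex, which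
  gives connectedness. In a cycle the largest vertex would be the upper end of two different
  edges.\<close>

lemma spanning_tree_if_unique_upper_edge:
  fixes n :: nat and ends :: "'e \<Rightarrow> nat set"
  assumes "T \<subseteq> A" "\<And>e. e \<in> T \<Longrightarrow> card (ends e) = 2"
    and ex: "\<And>v. 0 < v \<Longrightarrow> v < n \<Longrightarrow> \<exists>e\<in>T. \<exists>u<v. ends e = {u, v}"
    and uniq: "\<And>e e' u u' v. e \<in> T \<Longrightarrow> e' \<in> T \<Longrightarrow> u < v \<Longrightarrow> u' < v \<Longrightarrow>
      ends e = {u, v} \<Longrightarrow> ends e' = {u', v} \<Longrightarrow> e = e'"
  shows "spanning_tree {..<n} A ends T"
proof -
  let ?R = "{(x, y). \<exists>e\<in>T. ends e = {x, y}}"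
  have "sym ?R"
    by (auto simp: sym_def insert_commute)
  have root: "(v, 0) \<in> ?R\<^sup>*" if "v < n" for v
    using that
  proof (induction v rule: less_induct)
    case (less v)
    show ?case
    proof (cases "v = 0")
      case False
      then obtain e u where "e \<in> T" "u < v" "ends e = {u, v}"
        using ex less.prems by blast
      then have "(v, u) \<in> ?R" "(u, 0) \<in> ?R\<^sup>*"
        using less by (auto simp: insert_commute)
      then show ?thesis
        by (rule converse_rtrancl_into_rtrancl)
    qed simp
  qed
  have "connected_by {..<n} ends T"
    unfolding connected_by_def
  proof (intro ballI)
    fix u v assume "u \<in> {..<n}" "v \<in> {..<n}"
    then have "(u, 0) \<in> ?R\<^sup>*" "(0, v) \<in> ?R\<^sup>*"
      using root symD[OF sym_rtrancl[OF \<open>sym ?R\<close>]] by auto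
    then show "(u, v) \<in> ?R\<^sup>*"
      by (rule rtrancl_trans)
  qed
  moreover have "\<not> cycle_in ends T vs es" for vs es
  proof
    assume "cycle_in ends T vs es"
    then have c: "es \<noteq> []" "length vs = length es" "distinct es" "set es \<subseteq> T"
        "\<And>i. i < length es \<Longrightarrow> ends (es ! i) = {vs ! i, vs ! (Suc i mod length es)}"
      unfolding cycle_in_def by auto
    let ?l = "length es"
    have "0 < ?l"
      using c by simp
    have "Max (set vs) \<in> set vs"
      using c by (intro Max_in) auto
    then obtain i where i: "i < ?l" "vs ! i = Max (set vs)"
      using c(2) by (metis in_set_conv_nth)
    \<comment> \<open>\<open>j\<close> is the cyclic predecessor of \<open>i\<close>, so the edges
      at positions \<open>i\<close> and \<open>j\<close> both meet the largest vertex. A cycle of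
      length 1, where \<open>i = j\<close>, fails because an edge has two distinct ends.\<close>
    define j where "j = (if i = 0 then ?l - 1 else i - 1)"
    have j: "j < ?l" "Suc j mod ?l = i"
      using i \<open>0 < ?l\<close> by (auto simp: j_def)
    let ?k = "Suc i mod ?l"
    have "?k < ?l"
      using \<open>0 < ?l\<close> by simp
    have le: "vs ! k \<le> vs ! i" if "k < ?l" for k
      using that i(2) c(2) by simp
    have ei: "es ! i \<in> T" "es ! j \<in> T"
      using c(4) i j by auto
    have ends: "ends (es ! i) = {vs ! ?k, vs ! i}" "ends (es ! j) = {vs ! j, vs ! i}"
      using c(5)[OF i(1)] c(5)[OF j(1)] j by auto
    then have "vs ! ?k \<noteq> vs ! i" "vs ! j \<noteq> vs ! i"
      using assms(2)[OF ei(1)] assms(2)[OF ei(2)] by auto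
    then have "vs ! ?k < vs ! i" "vs ! j < vs ! i"
      using le[OF \<open>?k < ?l\<close>] le[OF j(1)] by auto
    then have "es ! i = es ! j"
      using uniq ei ends by blast
    then have "i = j"
      using c(3) i j by (simp add: nth_eq_iff_index_eq)
    then show False
      using \<open>vs ! j \<noteq> vs ! i\<close> by simp
  qed
  ultimately show ?thesis
    using assms(1) unfolding spanning_tree_def by blast
qed

section \<open>Digits of the costs\<close>

text \<open>Parallel copies share a label, and the label determines endpoints and cost. A tree is a
  set of positions; its shape depends only on the set of labels at these positions.\<close>

datatype label = Match nat nat | Flag nat | Star nat

fun label_edge :: "nat \<Rightarrow> label \<Rightarrow> edge" where
  "label_edge b (Match u v) = (u, v, 2 * b ^ u + 5 * b ^ v)"
| "label_edge b (Flag u) = (0, u, 3 + 3 * b ^ u)"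
| "label_edge b (Star u) = (0, u, 3 * b ^ u)"

text \<open>The coefficient of \<open>b ^ w\<close> in the cost of the labelled edge.\<close>

fun digit :: "label \<Rightarrow> nat \<Rightarrow> nat" where
  "digit (Match u v) w = (if w = u then 2 else 0) + (if w = v then 5 else 0)"
| "digit (Flag u) w = (if w = 0 then 3 else 0) + (if w = u then 3 else 0)"
| "digit (Star u) w = (if w = u then 3 else 0)"

section \<open>The list of labels and their multiplicities\<close>

definition label_row :: "nat \<Rightarrow> nat set set \<Rightarrow> nat \<Rightarrow> label list" where
  "label_row n E u =
    (if u = 1 \<or> u = 2 then replicate 8 (Flag u) else []) @
    (if u \<ge> 2 then replicate (2 * n) (Star u) else []) @
    map (Match u) (filter (\<lambda>v. u < v \<and> {u, v} \<in> E) [0..<n])"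

definition labels :: "nat \<Rightarrow> nat set set \<Rightarrow> label list" where
  "labels n E = concat (map (label_row n E) [0..<n])"

lemma gadget_eq_labels: "gadget b n E n = map (label_edge b) (labels n E)"
proof -
  have "gadget_row b n E u = map (label_edge b) (label_row n E u)" for u
    unfolding gadget_row_def label_row_def star_edges_def match_edges_def by simp
  then show ?thesis
    unfolding gadget_def labels_def by (simp add: map_concat cong: map_cong)
qed

text \<open>The vertex in whose row the label is listed.\<close>

fun owner :: "label \<Rightarrow> nat" where
  "owner (Match u v) = u" | "owner (Flag u) = u" | "owner (Star u) = u"

definition is_label :: "nat \<Rightarrow> nat set set \<Rightarrow> label \<Rightarrow> bool" where
  "is_label n E l \<longleftrightarrow> (case l of
      Match u v \<Rightarrow> u < v \<and> v < n \<and> {u, v} \<in> E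
    | Flag u \<Rightarrow> (u = 1 \<or> u = 2) \<and> u < n
    | Star u \<Rightarrow> 2 \<le> u \<and> u < n)"

lemma set_label_row:
  "u < n \<Longrightarrow> l \<in> set (label_row n E u) \<longleftrightarrow> owner l = u \<and> is_label n E l"
  unfolding label_row_def is_label_def by (cases l) auto

lemma set_labels: "l \<in> set (labels n E) \<longleftrightarrow> is_label n E l"
proof -
  have "is_label n E l \<Longrightarrow> owner l < n"
    unfolding is_label_def by (cases l) auto
  then show ?thesis
    unfolding labels_def by (auto simp: set_label_row)
qed

lemma count_list_concat_map:
  "count_list (concat (map f xs)) y = (\<Sum>x\<leftarrow>xs. count_list (f x) y)"
  by (induction xs) auto

lemma count_list_replicate: "count_list (replicate k x) y = (if x = y then k else 0)"
  by (induction k) auto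

lemma count_list_map_filter_upt:
  "count_list (map (Match u) (filter P [0..<n])) (Match u v) = (if v < n \<and> P v then 1 else 0)"
  by (induction n) auto

text \<open>A label occurs in no row but that of its owner, so its multiplicity is read off from
  this row.\<close>

lemma count_labels:
  assumes "is_label n E l"
  shows "count_list (labels n E) l = (case l of Match u v \<Rightarrow> 1 | Flag u \<Rightarrow> 8 | Star u \<Rightarrow> 2 * n)"
proof -
  have "count_list (label_row n E u) l = 0" if "u \<noteq> owner l" for u
    unfolding label_row_def count_list_0_iff using that by auto
  then have "(\<Sum>u<n. count_list (label_row n E u) l) =
      (\<Sum>u<n. if u = owner l then count_list (label_row n E u) l else 0)"
    by (intro sum.cong) auto
  then have "count_list (labels n E) l =
      (\<Sum>u<n. if u = owner l then count_list (label_row n E u) l else 0)"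
    unfolding labels_def count_list_concat_map
    by (simp only: interv_sum_list_conv_sum_set_nat atLeast0LessThan set_upt)
  also have "\<dots> = count_list (label_row n E (owner l)) l"
    using assms by (cases l) (auto simp: is_label_def)
  also have "\<dots> = (case l of Match u v \<Rightarrow> 1 | Flag u \<Rightarrow> 8 | Star u \<Rightarrow> 2 * n)"
  proof (cases l)
    case (Match u v)
    then show ?thesis
      using assms by (auto simp: label_row_def count_list_replicate is_label_def
          count_list_map_filter_upt simp del: count_list.simps)
  next
    case (Flag u)
    have "count_list (map (Match u) vs) (Flag u) = 0" for vs
      by (simp add: count_list_0_iff image_iff)
    then show ?thesis
      using assms Flag by (auto simp: label_row_def count_list_replicate is_label_def)
  next
    case (Star u)
    have "count_list (map (Match u) vs) (Star u) = 0" for vs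
      by (simp add: count_list_0_iff image_iff)
    then show ?thesis
      using assms Star by (auto simp: label_row_def count_list_replicate is_label_def)
  qed
  finally show ?thesis .
qed

lemma card_positions: "card {i \<in> {..<length xs}. xs ! i = x} = count_list xs x"
  unfolding count_list_eq_length_filter length_filter_conv_card
  by (intro arg_cong[where f = card]) auto

section \<open>Digit sums without carries\<close>

lemma sum_single_digit:
  fixes b :: nat
  assumes "u < n"
  shows "(\<Sum>w<n. (if w = u then c else 0) * b ^ w) = c * b ^ u"
proof -
  have "(\<Sum>w<n. (if w = u then c else 0) * b ^ w) = (\<Sum>w<n. if w = u then c * b ^ w else 0)"
    by (rule sum.cong) auto
  then show ?thesis
    using assms by simp
qed

lemma cost_eq_digit_sum:
  assumes "is_label n E l" "n > 0"
  shows "snd (snd (label_edge b l)) = (\<Sum>w<n. digit l w * b ^ w)"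
proof (cases l)
  case (Match u v)
  then show ?thesis
    using assms by (auto simp: is_label_def add_mult_distrib sum.distrib sum_single_digit)
next
  case (Flag u)
  then show ?thesis
    using assms by (auto simp: is_label_def add_mult_distrib sum.distrib sum_single_digit)
next
  case (Star u)
  then show ?thesis
    using assms by (auto simp: is_label_def sum_single_digit)
qed

text \<open>Eight flagged edges give at most 6 each, hence 48. At \<open>w = u\<close> the
  \<open>2 * n\<close> star edges give 3 each and at most \<open>n\<close> matching edges give 2
  each, hence \<open>8 * n\<close>. At most one matching edge of the row has upper end
  \<open>w\<close>, which gives 5.\<close>

lemma digit_row_sum:
  "(\<Sum>l\<leftarrow>label_row n E u. digit l w) \<le>
    (if u \<in> {1, 2} then 48 else 0) + (if u = w then 8 * n else 0) + 5"
proof -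
  have match: "(\<Sum>l\<leftarrow>map (Match u) (filter P [0..<k]). digit l w)
      \<le> (if u = w then 2 * k else 0) + (if w < k then 5 else 0)" for P k
    by (induction k) (auto simp del: sum_list_eq_0_iff split: if_splits)
  have flag: "(\<Sum>l\<leftarrow>(if u = 1 \<or> u = 2 then replicate 8 (Flag u) else []). digit l w)
      \<le> (if u \<in> {1, 2} then 48 else 0)"
    by (simp add: sum_list_replicate)
  have star: "(\<Sum>l\<leftarrow>(if u \<ge> 2 then replicate (2 * n) (Star u) else []). digit l w)
      \<le> (if u = w then 6 * n else 0)"
    by (simp add: sum_list_replicate)
  have "(\<Sum>l\<leftarrow>map (Match u) (filter (\<lambda>v. u < v \<and> {u, v} \<in> E) [0..<n]). digit l w)
      \<le> (if u = w then 2 * n else 0) + 5"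
    using match by (rule order_trans) simp
  from add_mono[OF flag add_mono[OF star this]]
  have "(\<Sum>l\<leftarrow>label_row n E u. digit l w) \<le> (if u \<in> {1, 2} then 48 else 0) +
      ((if u = w then 6 * n else 0) + ((if u = w then 2 * n else 0) + 5))"
    unfolding label_row_def map_append sum_list_append .
  also have "\<dots> = (if u \<in> {1, 2} then 48 else 0) + (if u = w then 8 * n else 0) + 5"
    by simp
  finally show ?thesis .
qed

text \<open>Over all rows the bound is \<open>96 + 13 * n\<close>, which is less than the base. So
  even the set of all edges produces no carry.\<close>

lemma digit_total:
  assumes "n \<ge> 3"
  shows "(\<Sum>i<length (labels n E). digit (labels n E ! i) w) < 64 * n"
proof -
  have "(\<Sum>i<length (labels n E). digit (labels n E ! i) w) = (\<Sum>l\<leftarrow>labels n E. digit l w)"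
    by (simp add: sum_list_sum_nth atLeast0LessThan)
  also have "\<dots> = (\<Sum>u<n. \<Sum>l\<leftarrow>label_row n E u. digit l w)"
  proof -
    have "(\<Sum>l\<leftarrow>concat (map f xs). digit l w) = (\<Sum>x\<leftarrow>xs. \<Sum>l\<leftarrow>f x. digit l w)" for f and xs :: "nat list"
      by (induction xs) auto
    then show ?thesis
      unfolding labels_def by (simp add: interv_sum_list_conv_sum_set_nat atLeast0LessThan)
  qed
  also have "\<dots> \<le> (\<Sum>u<n. (if u \<in> {1, 2} then 48 else 0) + (if u = w then 8 * n else 0) + 5)"
    by (intro sum_mono digit_row_sum)
  also have "\<dots> = (\<Sum>u<n. if u \<in> {1, 2} then 48 else 0) + (\<Sum>u<n. if u = w then 8 * n else 0) + 5 * n"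
    by (simp add: sum.distrib)
  \<comment> \<open>Both flagged rows exist because \<open>n\<close> is at least 3.\<close>
  also have "(\<Sum>u<n. if u \<in> {1, 2} then 48 else 0) = (\<Sum>u\<in>{1, 2 :: nat}. 48 :: nat)"
    using assms by (intro sum.mono_neutral_cong_right) auto
  also have "\<dots> + (\<Sum>u<n. if u = w then 8 * n else 0) + 5 * n \<le> 96 + 8 * n + 5 * n"
    by simp
  finally show ?thesis
    using assms by simp
qed

text \<open>The digit sums of any edge set stay below the base, so they are the base expansion of
  its cost and can be compared with that of \<open>C\<close>.\<close>

lemma cost_iff_digits:
  assumes "n \<ge> 3" "T \<subseteq> {..<length (labels n E)}"
  shows "(\<Sum>i\<in>T. edge_cost (gadget (64 * n) n E n) i) = 5 * (\<Sum>w<n. (64 * n) ^ w) \<longleftrightarrow>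
    (\<forall>w<n. (\<Sum>i\<in>T. digit (labels n E ! i) w) = 5)"
proof -
  let ?d = "\<lambda>w. \<Sum>i\<in>T. digit (labels n E ! i) w" and ?b = "64 * n"
  have "edge_cost (gadget ?b n E n) i = (\<Sum>w<n. digit (labels n E ! i) w * ?b ^ w)" if "i \<in> T" for i
  proof -
    have "i < length (labels n E)"
      using that assms(2) by auto
    then have "is_label n E (labels n E ! i)"
      using assms(1) set_labels nth_mem by blast
    from cost_eq_digit_sum[OF this, of ?b] show ?thesis
      using \<open>i < _\<close> assms(1) unfolding edge_cost_def gadget_eq_labels by (simp add: case_prod_unfold)
  qed
  then have "(\<Sum>i\<in>T. edge_cost (gadget ?b n E n) i) = (\<Sum>i\<in>T. \<Sum>w<n. digit (labels n E ! i) w * ?b ^ w)"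
    by (rule sum.cong[OF refl])
  also have "\<dots> = (\<Sum>w<n. ?d w * ?b ^ w)"
    unfolding sum_distrib_right by (rule sum.swap)
  finally have cost: "(\<Sum>i\<in>T. edge_cost (gadget ?b n E n) i) = (\<Sum>w<n. ?d w * ?b ^ w)" .
  have less: "?d w < ?b" for w
  proof -
    have "?d w \<le> (\<Sum>i<length (labels n E). digit (labels n E ! i) w)"
      using assms(2) by (intro sum_mono2) auto
    then show ?thesis
      using digit_total[OF assms(1), of E w] by simp
  qed
  show ?thesis
  proof
    assume "(\<Sum>i\<in>T. edge_cost (gadget ?b n E n) i) = 5 * (\<Sum>w<n. ?b ^ w)"
    then have *: "(\<Sum>w<n. ?d w * ?b ^ w) = (\<Sum>w<n. 5 * ?b ^ w)"
      unfolding cost sum_distrib_left .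
    \<comment> \<open>The digits of \<open>C\<close> must lie below the base as well.\<close>
    have "5 < ?b"
      using assms(1) by simp
    with less show "\<forall>w<n. ?d w = 5"
      by (intro allI impI, intro base_digits_unique[OF _ _ *])
  next
    assume "\<forall>w<n. ?d w = 5"
    then show "(\<Sum>i\<in>T. edge_cost (gadget ?b n E n) i) = 5 * (\<Sum>w<n. ?b ^ w)"
      unfolding cost sum_distrib_left by (intro sum.cong) auto
  qed
qed

section \<open>The trees of a perfect matching\<close>

lemma perfect_matching_unique:
  "perfect_matching V E M \<Longrightarrow> v \<in> V \<Longrightarrow> e \<in> M \<Longrightarrow> v \<in> e \<Longrightarrow> e' \<in> M \<Longrightarrow> v \<in> e' \<Longrightarrow> e = e'"
  unfolding perfect_matching_def by blast

lemma simple_graph_edge: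
  fixes E :: "nat set set"
  assumes "simple_graph {..<n} E" "e \<in> E"
  obtains u v where "e = {u, v}" "u < v" "v < n"
proof -
  have "card e = 2" "e \<subseteq> {..<n}"
    using assms unfolding simple_graph_def by auto
  then obtain x y where "e = {x, y}" "x \<noteq> y"
    by (auto simp: card_2_iff)
  then show thesis
    using that[of x y] that[of y x] \<open>e \<subseteq> {..<n}\<close> by (cases "x < y") (auto simp: insert_commute)
qed

lemma finite_edges: "simple_graph {..<n :: nat} E \<Longrightarrow> finite E"
  by (rule finite_subset[of _ "Pow {..<n}"]) (auto simp: simple_graph_def)

lemma perfect_matching_partner:
  fixes E :: "nat set set"
  assumes "simple_graph {..<n} E" "perfect_matching {..<n} E M" "w < n"
  obtains x where "{w, x} \<in> M" "x \<noteq> w" "x < n"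
proof -
  obtain e where e: "e \<in> M" "w \<in> e"
    using assms(2,3) unfolding perfect_matching_def by blast
  then have "e \<in> E"
    using assms(2) unfolding perfect_matching_def by blast
  then obtain u v where "e = {u, v}" "u < v" "v < n"
    using assms(1) by (elim simple_graph_edge)
  then show thesis
    using that[of u] that[of v] e by (auto simp: insert_commute)
qed

text \<open>Among lower ends other than 0 exactly one receives a flag: if \<open>{0, 1}\<close> is
  in \<open>M\<close>, then 1 is an upper end and 2 is flagged; otherwise 1 is.\<close>

definition star_label :: "nat set set \<Rightarrow> nat \<Rightarrow> label" where
  "star_label M u = (if u = 1 \<or> u = 2 \<and> {0, 1} \<in> M then Flag u else Star u)"

definition lower_ends :: "nat set set \<Rightarrow> nat set" where
  "lower_ends M = {u. \<exists>v>u. {u, v} \<in> M}"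

definition tree_labels :: "nat set set \<Rightarrow> label set" where
  "tree_labels M = {Match u v | u v. u < v \<and> {u, v} \<in> M} \<union> star_label M ` (lower_ends M - {0})"

lemma tree_labels_simps:
  "Match u v \<in> tree_labels M \<longleftrightarrow> u < v \<and> {u, v} \<in> M"
  "Flag u \<in> tree_labels M \<longleftrightarrow> u \<in> lower_ends M \<and> (u = 1 \<or> u = 2 \<and> {0, 1} \<in> M)"
  "Star u \<in> tree_labels M \<longleftrightarrow> u \<in> lower_ends M \<and> u \<noteq> 0 \<and> \<not> (u = 1 \<or> u = 2 \<and> {0, 1} \<in> M)"
  unfolding tree_labels_def star_label_def by auto

section \<open>Lower and upper ends of the edges of a perfect matching\<close>

locale matching =
  fixes n :: nat and E M :: "nat set set"
  assumes n: "n \<ge> 3" and graph: "simple_graph {..<n} E" and pm: "perfect_matching {..<n} E M"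
begin

lemma edge:
  assumes "e \<in> M"
  obtains u v where "e = {u, v}" "u < v" "v < n"
proof -
  have "e \<in> E"
    using assms pm unfolding perfect_matching_def by blast
  with graph show thesis
    by (rule simple_graph_edge) (rule that)
qed

lemma edge_bounds: "{u, v} \<in> M \<Longrightarrow> u < n \<and> v < n \<and> u \<noteq> v"
  by (erule edge) (auto simp: doubleton_eq_iff)

lemma partner_unique:
  assumes "{u, v} \<in> M" "{u, w} \<in> M"
  shows "v = w"
proof -
  have "{u, v} = {u, w}"
    using perfect_matching_unique[OF pm, of u] assms edge_bounds[OF assms(1)] by simp
  then show ?thesis
    using edge_bounds[OF assms(1)] edge_bounds[OF assms(2)] by (auto simp: doubleton_eq_iff)
qed

lemma partner: "w < n \<Longrightarrow> \<exists>x. {w, x} \<in> M"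
  using perfect_matching_partner[OF graph pm] by metis

lemma lower_endI: "{u, v} \<in> M \<Longrightarrow> u < v \<Longrightarrow> u \<in> lower_ends M"
  unfolding lower_ends_def by blast

lemma lower_endE:
  assumes "u \<in> lower_ends M"
  obtains v where "u < v" "{u, v} \<in> M"
  using assms unfolding lower_ends_def by blast

lemma upper_not_lower:
  assumes "{u, v} \<in> M" "u < v"
  shows "v \<notin> lower_ends M"
proof
  assume "v \<in> lower_ends M"
  then obtain w where "v < w" "{v, w} \<in> M"
    by (rule lower_endE)
  then show False
    using partner_unique[of v u w] assms by (simp add: insert_commute)
qed

lemma zero_lower: "0 \<in> lower_ends M"
proof -
  obtain x where "{0, x} \<in> M"
    using partner[of 0] n by auto
  then show ?thesis
    using edge_bounds[of 0 x] by (auto intro: lower_endI)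
qed

text \<open>Together with \<open>two_lower\<close> this shows that the vertex to be flagged is
  always a lower end. The partner of 1 is neither 0 nor 1.\<close>

lemma one_lower: "{0, 1} \<notin> M \<Longrightarrow> 1 \<in> lower_ends M"
proof -
  assume a: "{0, 1} \<notin> M"
  obtain x where x: "{1, x} \<in> M"
    using partner[of 1] n by auto
  have "x \<noteq> 0"
    using x a by (metis insert_commute)
  moreover have "x \<noteq> 1"
    using edge_bounds[OF x] by simp
  ultimately have "1 < x"
    by simp
  then show ?thesis
    using x by (intro lower_endI)
qed

text \<open>0 and 1 are partners of each other, so the partner of 2 must be larger than 2.\<close>

lemma two_lower: "{0, 1} \<in> M \<Longrightarrow> 2 \<in> lower_ends M"
proof -
  assume a: "{0, 1} \<in> M"
  obtain x where x: "{2, x} \<in> M"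
    using partner[of 2] n by auto
  have "x \<noteq> 0"
    using partner_unique[of 0 1 2] a x by (metis insert_commute numeral_eq_one_iff semiring_norm(85))
  moreover have "x \<noteq> 1"
    using partner_unique[of 1 0 2] a x by (metis insert_commute zero_neq_numeral)
  ultimately have "2 < x"
    using edge_bounds[OF x] by auto
  then show ?thesis
    using x by (intro lower_endI)
qed

lemma finite_lower_ends: "finite (lower_ends M)"
  by (rule finite_subset[of _ "{..<n}"]) (use edge_bounds in \<open>auto simp: lower_ends_def\<close>)

section \<open>The labels of a matching have all digits 5\<close>

lemma tree_labels_subset:
  assumes "l \<in> tree_labels M"
  shows "is_label n E l"
proof (cases l)
  case (Match u v)
  then show ?thesis
    using assms edge_bounds pm
    by (auto simp: tree_labels_simps is_label_def perfect_matching_def)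
next
  case (Flag u)
  then show ?thesis
    using assms edge_bounds by (auto simp: tree_labels_simps is_label_def elim!: lower_endE)
next
  case (Star u)
  then have "u < n" "u \<noteq> 0" "u \<noteq> 1"
    using assms edge_bounds by (auto simp: tree_labels_simps elim!: lower_endE)
  then show ?thesis
    using Star by (simp add: is_label_def)
qed

lemma finite_tree_labels: "finite (tree_labels M)"
  using tree_labels_subset set_labels by (metis finite_set finite_subset subsetI)

text \<open>This and the next two lemmas list the contributions to each digit: 2 from the matching
  edge and 3 from the only flag at 0, 5 from the matching edge at an upper end, and 2 plus 3 from
  the star label at any other lower end.\<close>

lemma digit_support_zero:
  assumes "{0, x} \<in> M"
  shows "{l \<in> tree_labels M. digit l 0 \<noteq> 0} = {Match 0 x, Flag (if x = 1 then 2 else 1)}"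
proof (intro set_eqI)
  have x: "0 < x"
    using edge_bounds[OF assms] by simp
  have m: "{0, v} \<in> M \<longleftrightarrow> v = x" for v
    using assms partner_unique by blast
  have f1: "1 \<in> lower_ends M \<longleftrightarrow> x \<noteq> 1"
    using one_lower upper_not_lower[of 0 1] m[of 1] by auto
  have f2: "x = 1 \<Longrightarrow> 2 \<in> lower_ends M"
    using two_lower m[of 1] by simp
  fix l show "l \<in> {l \<in> tree_labels M. digit l 0 \<noteq> 0} \<longleftrightarrow> l \<in> {Match 0 x, Flag (if x = 1 then 2 else 1)}"
  proof (cases l)
    case (Match u v)
    then show ?thesis
      using x m by (auto simp: tree_labels_simps)
  next
    case (Flag u)
    then show ?thesis
      using m[of 1] f1 f2 by (cases "x = 1") (auto simp: tree_labels_simps)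
  next
    case (Star u)
    then show ?thesis
      by (auto simp: tree_labels_simps)
  qed
qed

lemma digit_support_upper:
  assumes "{x, w} \<in> M" "x < w"
  shows "{l \<in> tree_labels M. digit l w \<noteq> 0} = {Match x w}"
proof (intro set_eqI)
  have nl: "w \<notin> lower_ends M"
    using upper_not_lower assms by blast
  have nu: "\<not> (w < v \<and> {w, v} \<in> M)" for v
    using nl lower_endI by blast
  have m: "{u, w} \<in> M \<longleftrightarrow> u = x" for u
    using partner_unique[of w u x] assms by (auto simp: insert_commute)
  fix l show "l \<in> {l \<in> tree_labels M. digit l w \<noteq> 0} \<longleftrightarrow> l \<in> {Match x w}"
  proof (cases l)
    case (Match u v)
    then show ?thesis
      using assms(2) m[of u] nu[of v] by (auto simp: tree_labels_simps)
  qed (use assms(2) nl in \<open>auto simp: tree_labels_simps\<close>)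
qed

lemma digit_support_lower:
  assumes "{w, x} \<in> M" "w < x" "w \<noteq> 0"
  shows "{l \<in> tree_labels M. digit l w \<noteq> 0} = {Match w x, star_label M w}"
proof (intro set_eqI)
  have l: "w \<in> lower_ends M"
    using lower_endI assms by blast
  have no: "\<not> (u < w \<and> {u, w} \<in> M)" for u
    using upper_not_lower l by blast
  have m: "{w, v} \<in> M \<longleftrightarrow> v = x" for v
    using partner_unique[of w v x] assms by blast
  fix l show "l \<in> {l \<in> tree_labels M. digit l w \<noteq> 0} \<longleftrightarrow> l \<in> {Match w x, star_label M w}"
  proof (cases l)
    case (Match u v)
    then show ?thesis
      using assms(2) m[of v] no[of u] by (auto simp: tree_labels_simps star_label_def)
  qed (use assms(3) l in \<open>auto simp: tree_labels_simps star_label_def\<close>)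
qed

lemma digit_sum_tree_labels:
  assumes "w < n"
  shows "(\<Sum>l\<in>tree_labels M. digit l w) = 5"
proof -
  have eq: "(\<Sum>l\<in>tree_labels M. digit l w) = (\<Sum>l\<in>{l \<in> tree_labels M. digit l w \<noteq> 0}. digit l w)"
    using finite_tree_labels by (intro sum.mono_neutral_right) auto
  obtain x where x: "{w, x} \<in> M"
    using partner assms by blast
  then have "x \<noteq> w"
    using edge_bounds by blast
  then consider "w = 0" | "x < w" | "w < x" "w \<noteq> 0"
    by linarith
  then show ?thesis
  proof cases
    case 1
    then have "x \<noteq> 0" "{0, x} \<in> M"
      using x \<open>x \<noteq> w\<close> by auto
    then show ?thesis
      unfolding eq unfolding 1 digit_support_zero[OF \<open>{0, x} \<in> M\<close>] by simp
  next
    case 2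
    have "{x, w} \<in> M"
      using x by (simp only: insert_commute)
    then show ?thesis
      unfolding eq digit_support_upper[OF \<open>{x, w} \<in> M\<close> 2] using 2 by simp
  next
    case 3
    then show ?thesis
      unfolding eq digit_support_lower[OF x 3] by (simp add: star_label_def)
  qed
qed

end

text \<open>The \<open>Match\<close> labels recover the matching. One inclusion is proved for
  arbitrary \<open>M\<close> and \<open>M'\<close> and used in both directions.\<close>

lemma tree_labels_inj:
  fixes E :: "nat set set"
  assumes "n \<ge> 3" "simple_graph {..<n} E" "perfect_matching {..<n} E M" "perfect_matching {..<n} E M'"
    and "tree_labels M = tree_labels M'"
  shows "M = M'"
proof -
  have "M \<subseteq> M'" if "n \<ge> 3" "simple_graph {..<n} E" "perfect_matching {..<n} E M"
      "tree_labels M = tree_labels M'" for M M' :: "nat set set"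
  proof
    interpret matching n E M
      using that by unfold_locales
    fix e assume e: "e \<in> M"
    then obtain u v where "e = {u, v}" "u < v"
      by (elim edge)
    then show "e \<in> M'"
      using e that(4) tree_labels_simps(1) by blast
  qed
  then show ?thesis
    using assms by blast
qed

section \<open>From digits equal to 5 back to a perfect matching\<close>

lemma digit_range: "is_label n E l \<Longrightarrow> digit l w \<in> {0, 2, 3, 5}"
  by (cases l) (auto simp: is_label_def)

lemma digit_nonzero_exists: "is_label n E l \<Longrightarrow> \<exists>w<n. digit l w \<noteq> 0"
  by (cases l) (auto simp: is_label_def)

text \<open>The two positions touched by a valid label differ, so its contributions never add up and
  the value of a digit reveals the kind of label; the same holds for 5 and 3 below.\<close>

lemma digit_two:
  assumes "is_label n E l" "digit l w = 2"
  obtains v where "l = Match w v"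
  using assms that by (cases l) (auto simp: is_label_def split: if_splits)

lemma digit_five:
  assumes "is_label n E l" "digit l w = 5"
  obtains u where "l = Match u w"
  using assms that by (cases l) (auto simp: is_label_def split: if_splits)

lemma digit_three:
  assumes "is_label n E l" "digit l w = 3"
  shows "w = 0 \<and> (\<exists>u. l = Flag u) \<or> w \<noteq> 0 \<and> (l = Flag w \<or> l = Star w)"
  using assms by (cases l) (auto simp: is_label_def split: if_splits)

text \<open>The hypotheses are the conclusions of \<open>sum_eq_five\<close> for every digit. The
  \<open>Match\<close> labels form the matching: each digit has a 5 or a 2, so every vertex is
  covered. A 3 at \<open>u > 0\<close> needs a 2 there and conversely, so the remaining labels sit
  exactly at the lower ends other than 0. Digit 0 decides which of them is a flag.\<close>

lemma labels_with_digits_five: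
  fixes L :: "label set"
  assumes n: "n \<ge> 3" and graph: "simple_graph {..<n} E"
    and lab: "\<And>l. l \<in> L \<Longrightarrow> is_label n E l"
    and same: "\<And>w l l'. w < n \<Longrightarrow> l \<in> L \<Longrightarrow> l' \<in> L \<Longrightarrow> digit l w \<noteq> 0 \<Longrightarrow> digit l w = digit l' w \<Longrightarrow> l = l'"
    and five: "\<And>w l l'. w < n \<Longrightarrow> l \<in> L \<Longrightarrow> l' \<in> L \<Longrightarrow> digit l w = 5 \<Longrightarrow> digit l' w \<noteq> 0 \<Longrightarrow> l = l'"
    and two: "\<And>w l. w < n \<Longrightarrow> l \<in> L \<Longrightarrow> digit l w = 2 \<Longrightarrow> \<exists>l'\<in>L. digit l' w = 3"
    and three: "\<And>w l. w < n \<Longrightarrow> l \<in> L \<Longrightarrow> digit l w = 3 \<Longrightarrow> \<exists>l'\<in>L. digit l' w = 2"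
    and ex: "\<And>w. w < n \<Longrightarrow> \<exists>l\<in>L. digit l w = 5 \<or> digit l w = 2"
  shows "\<exists>M. perfect_matching {..<n} E M \<and> L = tree_labels M"
proof -
  define M where "M = {{u, v} | u v. Match u v \<in> L}"
  have match: "u < v \<and> v < n \<and> {u, v} \<in> E" if "Match u v \<in> L" for u v
    using lab[OF that] by (simp add: is_label_def)
  have M_iff: "{u, v} \<in> M \<and> u < v \<longleftrightarrow> Match u v \<in> L" for u v
  proof
    assume "{u, v} \<in> M \<and> u < v"
    then obtain u' v' where "Match u' v' \<in> L" "{u, v} = {u', v'}" "u < v"
      unfolding M_def by blast
    then show "Match u v \<in> L"
      using match[of u' v'] by (auto simp: doubleton_eq_iff)
  next
    assume "Match u v \<in> L"
    then show "{u, v} \<in> M \<and> u < v"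
      using match unfolding M_def by blast
  qed
  have pm: "perfect_matching {..<n} E M"
    unfolding perfect_matching_def
  proof (intro conjI ballI)
    show "M \<subseteq> E"
      using match unfolding M_def by blast
    fix w assume "w \<in> {..<n}"
    then have w: "w < n"
      by simp
    show "\<exists>!e. e \<in> M \<and> w \<in> e"
    proof (rule ex_ex1I)
      obtain l where l: "l \<in> L" "digit l w = 5 \<or> digit l w = 2"
        using ex[OF w] by blast
      from l(2) have "\<exists>u v. l = Match u v \<and> w \<in> {u, v}"
      proof
        assume "digit l w = 5"
        then show ?thesis
          by (rule digit_five[OF lab[OF l(1)]]) simp
      next
        assume "digit l w = 2"
        then show ?thesis
          by (rule digit_two[OF lab[OF l(1)]]) simp
      qed
      then obtain u v where uv: "l = Match u v" "w \<in> {u, v}"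
        by (elim exE conjE)
      then have "{u, v} \<in> M"
        using M_iff[of u v] l(1) by simp
      then show "\<exists>e. e \<in> M \<and> w \<in> e"
        using uv(2) by (intro exI conjI)
    next
      fix e e' assume w': "e \<in> M \<and> w \<in> e" "e' \<in> M \<and> w \<in> e'"
      obtain u v where uv: "e = {u, v}" "Match u v \<in> L"
        using w'(1) unfolding M_def by auto
      obtain u' v' where uv': "e' = {u', v'}" "Match u' v' \<in> L"
        using w'(2) unfolding M_def by auto
      note e = uv uv' w'(1)[unfolded uv, THEN conjunct2] w'(2)[unfolded uv', THEN conjunct2]
      obtain a a' where a: "digit (Match u v) w = a" "digit (Match u' v') w = a'"
        by blast
      have "a = 5 \<or> a = 2" "a' = 5 \<or> a' = 2"
        using e(5,6) match[OF e(2)] match[OF e(4)] unfolding a[symmetric] by auto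
      then consider "a = 5" "a' \<noteq> 0" | "a' = 5" "a \<noteq> 0" | "a \<noteq> 0" "a = a'"
        by fastforce
      then have "Match u v = Match u' v'"
      proof cases
        case 1
        then show ?thesis
          by (rule five[OF w e(2,4), unfolded a])
      next
        case 2
        then show ?thesis
          by (rule five[OF w e(4,2), unfolded a, symmetric])
      next
        case 3
        then show ?thesis
          by (rule same[OF w e(2,4), unfolded a])
      qed
      then show "e = e'"
        using e by simp
    qed
  qed
  interpret matching n E M
    using n graph pm by unfold_locales
  have lower: "u \<in> lower_ends M \<and> u \<noteq> 0" if l: "l \<in> L" "l = Flag u \<or> l = Star u" for l u
  proof -
    have u: "u \<noteq> 0" "u < n" "digit l u = 3"
      using lab[OF l(1)] l(2) by (auto simp: is_label_def)
    obtain l' where l': "l' \<in> L" "digit l' u = 2"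
      using three[OF u(2) l(1) u(3)] by (rule bexE)
    obtain v where "l' = Match u v"
      by (rule digit_two[OF lab[OF l'(1)] l'(2)])
    then show ?thesis
      using l'(1) u(1) M_iff[of u v] lower_endI[of u v] by simp
  qed
  have some_star: "Flag u \<in> L \<or> Star u \<in> L" if u: "u \<in> lower_ends M" "u \<noteq> 0" for u
  proof -
    obtain v where v: "u < v" "{u, v} \<in> M"
      using u(1) by (rule lower_endE)
    then have m: "Match u v \<in> L" "digit (Match u v) u = 2" "u < n"
      using M_iff[of u v] edge_bounds[of u v] by auto
    obtain l where l: "l \<in> L" "digit l u = 3"
      using two[OF m(3,1,2)] by (rule bexE)
    show ?thesis
      using digit_three[OF lab[OF l(1)] l(2)] u(2) l(1) by auto
  qed
  \<comment> \<open>If 2 were flagged without \<open>{0, 1}\<close> in \<open>M\<close>, then 1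
    would be a lower end and need a 3, which only \<open>Flag 1\<close> supplies; the two flags
    would clash in digit 0.\<close>
  have flag: "u = 1 \<or> u = 2 \<and> {0, 1} \<in> M" if u: "Flag u \<in> L" for u
  proof (rule ccontr)
    assume *: "\<not> ?thesis"
    have "u = 1 \<or> u = 2"
      using lab[OF u] by (simp add: is_label_def)
    then have 2: "u = 2" "{0, 1} \<notin> M"
      using * by auto
    then have "Flag 1 \<in> L"
      using some_star[OF one_lower] lab[of "Star 1"] by (auto simp: is_label_def)
    then show False
      using same[of 0 "Flag 1" "Flag 2"] u n unfolding 2(1) by simp
  qed
  \<comment> \<open>If \<open>{0, 1}\<close> is in \<open>M\<close>, its 2 in digit 0 calls for a
    flag. It cannot be at 1, which is an upper end, so it is \<open>Flag 2\<close>, and this clashes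
    with \<open>Star 2\<close> in digit 2.\<close>
  have star: "\<not> (u = 1 \<or> u = 2 \<and> {0, 1} \<in> M)" if s: "Star u \<in> L" for u
  proof
    assume *: "u = 1 \<or> u = 2 \<and> {0, 1} \<in> M"
    then have u: "u = 2" "{0, 1} \<in> M"
      using lab[OF s] by (auto simp: is_label_def)
    have "Match 0 1 \<in> L"
      using M_iff[of 0 1] u(2) by simp
    moreover have "0 < n" "digit (Match 0 1) 0 = 2"
      using n by auto
    ultimately obtain l where l: "l \<in> L" "digit l 0 = 3"
      using two[of 0 "Match 0 1"] by auto
    obtain x where x: "Flag x \<in> L"
      using digit_three[OF lab[OF l(1)] l(2)] l(1) by auto
    have "1 \<notin> lower_ends M"
      using upper_not_lower[OF u(2)] by simp
    then have "x = 2"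
      using flag[OF x] lower[OF x] by auto
    then show False
      using same[of 2 "Flag 2" "Star 2"] x s n unfolding u(1) by simp
  qed
  have "l \<in> L \<longleftrightarrow> l \<in> tree_labels M" for l
  proof (cases l)
    case (Match u v)
    then show ?thesis
      using M_iff[of u v] by (simp add: tree_labels_simps conj_commute)
  next
    case (Flag u)
    have "u = 1 \<or> u = 2 \<and> {0, 1} \<in> M \<Longrightarrow> u \<noteq> 0"
      by auto
    then show ?thesis
      unfolding Flag tree_labels_simps
      using flag[of u] lower[of "Flag u" u] star[of u] some_star[of u] by blast
  next
    case (Star u)
    show ?thesis
      unfolding Star tree_labels_simps
      using flag[of u] lower[of "Star u" u] star[of u] some_star[of u] by blast
  qed
  then have "L = tree_labels M"
    by (rule set_eqI)
  then show ?thesis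
    using pm by blast
qed

lemma digits_five_imp_tree_labels:
  assumes n: "n \<ge> 3" and graph: "simple_graph {..<n} E" and T: "T \<subseteq> {..<length (labels n E)}"
    and digits: "\<And>w. w < n \<Longrightarrow> (\<Sum>i\<in>T. digit (labels n E ! i) w) = 5"
  shows "\<exists>M. perfect_matching {..<n} E M \<and> inj_on ((!) (labels n E)) T \<and>
    (!) (labels n E) ` T = tree_labels M"
proof -
  let ?g = "(!) (labels n E)"
  have fin: "finite T"
    using T by (rule finite_subset) simp
  have lab: "is_label n E (?g i)" if "i \<in> T" for i
    using that T set_labels nth_mem by blast
  have range: "digit (?g i) w \<in> {0, 2, 3, 5}" if "i \<in> T" for i w
    using digit_range[OF lab[OF that]] .
  have S1: "i = j" if "w < n" "i \<in> T" "j \<in> T" "digit (?g i) w \<noteq> 0"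
      "digit (?g i) w = digit (?g j) w" for w i j
    by (rule sum_eq_five(1)[OF fin range digits]) (use that in auto)
  have S2: "i = j" if "w < n" "i \<in> T" "j \<in> T" "digit (?g i) w = 5" "digit (?g j) w \<noteq> 0" for w i j
    by (rule sum_eq_five(2)[OF fin range digits]) (use that in auto)
  have S3: "\<exists>j\<in>T. digit (?g j) w = 3" if "w < n" "i \<in> T" "digit (?g i) w = 2" for w i
    by (rule sum_eq_five(3)[OF fin range digits]) (use that in auto)
  have S4: "\<exists>j\<in>T. digit (?g j) w = 2" if "w < n" "i \<in> T" "digit (?g i) w = 3" for w i
    by (rule sum_eq_five(4)[OF fin range digits]) (use that in auto)
  have S5: "\<exists>i\<in>T. digit (?g i) w = 5 \<or> digit (?g i) w = 2" if "w < n" for w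
    by (rule sum_eq_five(5)[OF fin range digits]) (use that in auto)
  \<comment> \<open>Two copies of one label would contribute the same nonzero value to some
    digit.\<close>
  have "inj_on ?g T"
  proof (rule inj_onI)
    fix i j assume ij: "i \<in> T" "j \<in> T" "?g i = ?g j"
    obtain w where "w < n" "digit (?g i) w \<noteq> 0"
      using digit_nonzero_exists[OF lab[OF ij(1)]] by blast
    then show "i = j"
      using S1[of w i j] ij by simp
  qed
  moreover have "\<exists>M. perfect_matching {..<n} E M \<and> ?g ` T = tree_labels M"
  proof (rule labels_with_digits_five[OF n graph])
    fix w l l' assume w: "w < n" and "l \<in> ?g ` T" "l' \<in> ?g ` T"
    then obtain i j where ij: "i \<in> T" "j \<in> T" "l = ?g i" "l' = ?g j"
      by blast
    show "l = l'" if "digit l w \<noteq> 0" "digit l w = digit l' w"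
      using S1[OF w ij(1,2)] that unfolding ij by simp
    show "l = l'" if "digit l w = 5" "digit l' w \<noteq> 0"
      using S2[OF w ij(1,2)] that unfolding ij by simp
  next
    fix w l assume w: "w < n" and "l \<in> ?g ` T"
    then obtain i where i: "i \<in> T" "l = ?g i"
      by blast
    show "\<exists>l'\<in>?g ` T. digit l' w = 3" if "digit l w = 2"
      using S3[OF w i(1)] that unfolding i by simp
    show "\<exists>l'\<in>?g ` T. digit l' w = 2" if "digit l w = 3"
      using S4[OF w i(1)] that unfolding i by simp
  next
    fix w assume "w < n"
    then show "\<exists>l\<in>?g ` T. digit l w = 5 \<or> digit l w = 2"
      using S5[of w] by simp
  qed (use lab in blast)
  ultimately show ?thesis
    by blast
qed

section \<open>The trees of a matching: spanning property and number\<close>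

fun label_ends :: "label \<Rightarrow> nat set" where
  "label_ends (Match u v) = {u, v}" | "label_ends (Flag u) = {0, u}" | "label_ends (Star u) = {0, u}"

lemma edge_ends_gadget:
  "i < length (labels n E) \<Longrightarrow> edge_ends (gadget b n E n) i = label_ends (labels n E ! i)"
  unfolding edge_ends_def gadget_eq_labels by (cases "labels n E ! i") auto

context matching
begin

lemma upper_end_label:
  assumes "l \<in> tree_labels M" "label_ends l = {u, v}" "u < v"
  shows "l = Match u v \<and> {u, v} \<in> M \<or> l = star_label M v \<and> v \<in> lower_ends M"
  using assms by (cases l) (auto simp: tree_labels_simps star_label_def doubleton_eq_iff)

text \<open>A matching edge with upper end \<open>v\<close> excludes a star edge at
  \<open>v\<close>, since star edges go to lower ends; and each kind occurs at \<open>v\<close> at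
  most once.\<close>

lemma upper_end_unique:
  assumes "l \<in> tree_labels M" "l' \<in> tree_labels M" "u < v" "u' < v"
    "label_ends l = {u, v}" "label_ends l' = {u', v}"
  shows "l = l'"
proof -
  have "{u, v} \<in> M \<Longrightarrow> {u', v} \<in> M \<Longrightarrow> u = u'"
    using partner_unique[of v u u'] by (simp add: insert_commute)
  moreover have "{x, v} \<in> M \<Longrightarrow> x < v \<Longrightarrow> v \<notin> lower_ends M" for x
    by (rule upper_not_lower)
  ultimately show ?thesis
    using upper_end_label[OF assms(1,5,3)] upper_end_label[OF assms(2,6,4)] assms(3,4) by blast
qed

lemma upper_end_exists:
  assumes "0 < v" "v < n"
  shows "\<exists>l\<in>tree_labels M. \<exists>u<v. label_ends l = {u, v}"
proof -
  obtain x where x: "{v, x} \<in> M"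
    using partner assms(2) by blast
  then consider "x < v" | "v < x"
    using edge_bounds[OF x] by linarith
  then show ?thesis
  proof cases
    case 1
    then have "Match x v \<in> tree_labels M"
      using x by (simp add: tree_labels_simps insert_commute)
    then show ?thesis
      using 1 by force
  next
    case 2
    then have "star_label M v \<in> tree_labels M"
      using lower_endI[OF x] assms(1) unfolding tree_labels_def by blast
    moreover have "label_ends (star_label M v) = {0, v}"
      unfolding star_label_def by simp
    ultimately show ?thesis
      using assms(1) by blast
  qed
qed

lemma tree_labels_spanning_tree:
  assumes T: "T \<subseteq> {..<length (labels n E)}" "inj_on ((!) (labels n E)) T"
    "(!) (labels n E) ` T = tree_labels M"
  shows "spanning_tree {..<n} {..<length (labels n E)} (edge_ends (gadget b n E n)) T"
proof -
  let ?g = "(!) (labels n E)"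
  have ends: "edge_ends (gadget b n E n) i = label_ends (?g i)" if "i \<in> T" for i
    using that T(1) by (intro edge_ends_gadget) auto
  have mem: "?g i \<in> tree_labels M" if "i \<in> T" for i
    using that T(3) by blast
  show ?thesis
  proof (rule spanning_tree_if_unique_upper_edge[OF T(1)])
    fix i assume i: "i \<in> T"
    have "card (label_ends l) = 2" if "is_label n E l" for l
      using that by (cases l) (auto simp: is_label_def)
    then show "card (edge_ends (gadget b n E n) i) = 2"
      using ends[OF i] tree_labels_subset[OF mem[OF i]] by simp
  next
    fix v assume "0 < v" "v < n"
    then obtain l u where l: "l \<in> tree_labels M" "u < v" "label_ends l = {u, v}"
      using upper_end_exists by blast
    then have "l \<in> ?g ` T"
      using T(3) by simp
    then obtain i where "i \<in> T" "l = ?g i"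
      by (rule imageE)
    then show "\<exists>e\<in>T. \<exists>u<v. edge_ends (gadget b n E n) e = {u, v}"
      using l ends by blast
  next
    fix i j u u' v assume *: "i \<in> T" "j \<in> T" "u < v" "u' < v"
      "edge_ends (gadget b n E n) i = {u, v}" "edge_ends (gadget b n E n) j = {u', v}"
    then have "?g i = ?g j"
      using upper_end_unique[OF mem mem] ends by simp
    then show "i = j"
      using T(2) * by (simp add: inj_on_eq_iff)
  qed
qed

lemma tree_labels_digits:
  assumes "inj_on ((!) (labels n E)) T" "(!) (labels n E) ` T = tree_labels M" "w < n"
  shows "(\<Sum>i\<in>T. digit (labels n E ! i) w) = 5"
proof -
  have "(\<Sum>l\<in>tree_labels M. digit l w) = (\<Sum>i\<in>T. digit (labels n E ! i) w)"
    using sum.reindex[OF assms(1), of "\<lambda>l. digit l w"] unfolding assms(2) comp_def .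
  then show ?thesis
    using digit_sum_tree_labels[OF assms(3)] by (simp only:)
qed

text \<open>Sending a matching edge to its lower end and to its upper end gives two injections,
  whose images partition the vertices.\<close>

lemma card_lower_ends: "n = 2 * card (lower_ends M)"
proof -
  let ?A = "{(u, v). u < v \<and> {u, v} \<in> M}"
  have "inj_on fst ?A" "inj_on snd ?A"
    using partner_unique by (auto simp: inj_on_def insert_commute)
  moreover have "fst ` ?A = lower_ends M"
    unfolding lower_ends_def by force
  moreover have "snd ` ?A = {..<n} - lower_ends M"
  proof (intro set_eqI iffI)
    fix v assume "v \<in> snd ` ?A"
    then obtain u where "{u, v} \<in> M" "u < v"
      by auto
    then show "v \<in> {..<n} - lower_ends M"
      using edge_bounds upper_not_lower by blast
  next
    fix v assume v: "v \<in> {..<n} - lower_ends M"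
    then obtain u where u: "{v, u} \<in> M"
      using partner by blast
    then have "u < v"
      using edge_bounds[OF u] lower_endI[OF u] v by force
    then have "(u, v) \<in> ?A"
      using u by (simp add: insert_commute)
    then show "v \<in> snd ` ?A"
      by force
  qed
  ultimately have "card (lower_ends M) = card ({..<n} - lower_ends M)"
    using card_image[of fst ?A] card_image[of snd ?A] by (simp only:)
  moreover have "lower_ends M \<subseteq> {..<n}"
    using edge_bounds unfolding lower_ends_def by blast
  moreover from card_mono[OF _ this] have "card (lower_ends M) \<le> n"
    by simp
  ultimately show ?thesis
    using finite_lower_ends by (simp add: card_Diff_subset)
qed

text \<open>Matching edges have one copy each, the flagged edge has 8, and the remaining star edges
  have \<open>2 * n\<close> each. The exponent omits the lower end 0, which gets no star edge, and
  the flagged one.\<close>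

lemma prod_count_tree_labels:
  "(\<Prod>l\<in>tree_labels M. count_list (labels n E) l) = 8 * (2 * n) ^ (card (lower_ends M) - 2)"
proof -
  let ?c = "count_list (labels n E)" and ?Q = "lower_ends M - {0}"
  \<comment> \<open>\<open>f\<close> is the flagged lower end.\<close>
  define f where "f = (if {0, 1} \<in> M then 2 else 1 :: nat)"
  let ?A = "{Match u v | u v. u < v \<and> {u, v} \<in> M}"
  have fin: "finite ?A" "finite (star_label M ` ?Q)"
    using finite_tree_labels unfolding tree_labels_def by auto
  have disj: "?A \<inter> star_label M ` ?Q = {}"
    unfolding star_label_def by auto
  have inj: "inj_on (star_label M) ?Q"
    unfolding inj_on_def star_label_def by auto
  have one: "?c l = 1" if "l \<in> ?A" for l
  proof -
    have "is_label n E l"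
      using that unfolding tree_labels_def by (intro tree_labels_subset) (simp add: tree_labels_def)
    then show ?thesis
      using that count_labels by fastforce
  qed
  have star: "?c (star_label M u) = (if u = f then 8 else 2 * n)" if "u \<in> ?Q" for u
  proof -
    have "star_label M u \<in> tree_labels M"
      using that unfolding tree_labels_def by blast
    then have "?c (star_label M u) = (case star_label M u of Match u v \<Rightarrow> 1 | Flag u \<Rightarrow> 8 | Star u \<Rightarrow> 2 * n)"
      by (intro count_labels tree_labels_subset)
    moreover have "{0, 1} \<in> M \<Longrightarrow> u \<noteq> 1"
      using that upper_not_lower[of 0 1] by auto
    ultimately show ?thesis
      by (auto simp: star_label_def f_def)
  qed
  have f: "f \<in> ?Q"
    using one_lower two_lower by (simp add: f_def)
  have "card ?Q = card (lower_ends M) - 1"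
    using zero_lower by simp
  then have rest: "card (?Q - {f}) = card (lower_ends M) - 2"
    using f by (simp only: card_Diff_singleton)
  have "(\<Prod>l\<in>tree_labels M. ?c l) = (\<Prod>l\<in>?A. ?c l) * (\<Prod>l\<in>star_label M ` ?Q. ?c l)"
    unfolding tree_labels_def using fin disj by (rule prod.union_disjoint)
  also have "(\<Prod>l\<in>?A. ?c l) = 1"
    using one by (rule prod.neutral[OF ballI])
  also have "(\<Prod>l\<in>star_label M ` ?Q. ?c l) = (\<Prod>u\<in>?Q. if u = f then 8 else 2 * n)"
    unfolding prod.reindex[OF inj] comp_def using star by (rule prod.cong[OF refl])
  also have "\<dots> = 8 * (\<Prod>u\<in>?Q - {f}. if u = f then 8 else 2 * n)"
    using f finite_lower_ends by (subst prod.remove[of _ f]) auto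
  also have "(\<Prod>u\<in>?Q - {f}. if u = f then 8 else 2 * n) = (\<Prod>u\<in>?Q - {f}. 2 * n)"
    by (rule prod.cong) auto
  finally show ?thesis
    by (simp only: prod_constant rest mult_1)
qed

end

text \<open>The edge sets of cost \<open>C\<close> are grouped by the matching that their labels
  determine. The groups are disjoint, consist of spanning trees, and all have the size given by
  \<open>prod_count_tree_labels\<close>.\<close>

lemma ST_gadget:
  assumes n: "n \<ge> 3" and graph: "simple_graph {..<n} E"
  shows "ST {..<n} {..<length (gadget (64 * n) n E n)} (edge_ends (gadget (64 * n) n E n))
    (edge_cost (gadget (64 * n) n E n)) (5 * (\<Sum>w<n. (64 * n) ^ w)) =
    PM {..<n} E * (8 * (2 * n) ^ (n div 2 - 2))"
proof -
  let ?es = "gadget (64 * n) n E n" and ?I = "{..<length (labels n E)}" and ?g = "(!) (labels n E)"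
  let ?P = "{M. perfect_matching {..<n} E M}"
  define S where "S = (\<lambda>D. {T. T \<subseteq> ?I \<and> inj_on ?g T \<and> ?g ` T = D})"
  have len: "length ?es = length (labels n E)"
    by (simp add: gadget_eq_labels)
  have mat: "matching n E M" if "M \<in> ?P" for M
    using n graph that by unfold_locales auto
  have trees: "{T. spanning_tree {..<n} ?I (edge_ends ?es) T \<and>
      (\<Sum>i\<in>T. edge_cost ?es i) = 5 * (\<Sum>w<n. (64 * n) ^ w)} = (\<Union>M\<in>?P. S (tree_labels M))"
  proof (intro set_eqI iffI)
    fix T assume "T \<in> {T. spanning_tree {..<n} ?I (edge_ends ?es) T \<and>
      (\<Sum>i\<in>T. edge_cost ?es i) = 5 * (\<Sum>w<n. (64 * n) ^ w)}"
    then have T: "T \<subseteq> ?I" "(\<Sum>i\<in>T. edge_cost ?es i) = 5 * (\<Sum>w<n. (64 * n) ^ w)"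
      unfolding spanning_tree_def by auto
    \<comment> \<open>The total cost fixes all digit sums, and these force the set of
      labels.\<close>
    then have "(\<Sum>i\<in>T. digit (labels n E ! i) w) = 5" if "w < n" for w
      using cost_iff_digits[OF n T(1)] that by blast
    from digits_five_imp_tree_labels[OF n graph T(1) this]
    show "T \<in> (\<Union>M\<in>?P. S (tree_labels M))"
      unfolding S_def using T(1) by blast
  next
    fix T assume "T \<in> (\<Union>M\<in>?P. S (tree_labels M))"
    then obtain M where M: "M \<in> ?P" and T: "T \<subseteq> ?I" "inj_on ?g T" "?g ` T = tree_labels M"
      unfolding S_def by blast
    interpret matching n E M
      using M by (rule mat)
    show "T \<in> {T. spanning_tree {..<n} ?I (edge_ends ?es) T \<and>
      (\<Sum>i\<in>T. edge_cost ?es i) = 5 * (\<Sum>w<n. (64 * n) ^ w)}"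
      using tree_labels_spanning_tree[OF T] tree_labels_digits[OF T(2,3)]
        cost_iff_digits[OF n T(1)] by simp
  qed
  have fin: "finite ?P"
    using finite_edges[OF graph]
    by (rule finite_subset[rotated, OF finite_Pow_iff[THEN iffD2]]) (auto simp: perfect_matching_def)
  have "ST {..<n} {..<length ?es} (edge_ends ?es) (edge_cost ?es) (5 * (\<Sum>w<n. (64 * n) ^ w)) =
      card (\<Union>M\<in>?P. S (tree_labels M))"
    unfolding ST_def len trees ..
  also have "\<dots> = (\<Sum>M\<in>?P. card (S (tree_labels M)))"
  proof (rule card_UN_disjoint[OF fin])
    show "\<forall>M\<in>?P. finite (S (tree_labels M))"
      unfolding S_def by (rule ballI, rule finite_subset[of _ "Pow ?I"]) auto
    show "\<forall>M\<in>?P. \<forall>M'\<in>?P. M \<noteq> M' \<longrightarrow> S (tree_labels M) \<inter> S (tree_labels M') = {}"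
    proof (intro ballI impI)
      fix M M' assume *: "M \<in> ?P" "M' \<in> ?P" "M \<noteq> M'"
      then have "tree_labels M \<noteq> tree_labels M'"
        using tree_labels_inj[OF n graph] by blast
      then show "S (tree_labels M) \<inter> S (tree_labels M') = {}"
        unfolding S_def by blast
    qed
  qed
  also have "\<dots> = (\<Sum>M\<in>?P. 8 * (2 * n) ^ (n div 2 - 2))"
  proof (rule sum.cong[OF refl])
    fix M assume "M \<in> ?P"
    then interpret matching n E M
      by (rule mat)
    have "card (S (tree_labels M)) = (\<Prod>l\<in>tree_labels M. count_list (labels n E) l)"
      unfolding S_def card_injective_selections[OF finite_lessThan finite_tree_labels] card_positions ..
    also have "\<dots> = 8 * (2 * n) ^ (n div 2 - 2)"
      unfolding prod_count_tree_labels using card_lower_ends by simp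
    finally show "card (S (tree_labels M)) = 8 * (2 * n) ^ (n div 2 - 2)" .
  qed
  also have "\<dots> = PM {..<n} E * (8 * (2 * n) ^ (n div 2 - 2))"
    unfolding PM_def by simp
  finally show ?thesis .
qed

section \<open>The remaining cases\<close>

text \<open>Each edge is counted once, as the pair of its ends in increasing order. This identifies
  the number computed by the machine with the number of edges.\<close>

lemma edge_count_eq_card:
  fixes E :: "nat set set"
  assumes "simple_graph {..<n} E"
  shows "edge_count n E n = card E"
proof -
  let ?A = "SIGMA u:{..<n}. {v. v < n \<and> u < v \<and> {u, v} \<in> E}"
  have len: "length (filter P [0..<n]) = card {v. v < n \<and> P v}" for P
    unfolding length_filter_conv_card by (intro arg_cong[where f = card]) auto
  have "edge_count n E n = card ?A"
    unfolding edge_count_def len by (subst card_SigmaI) auto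
  also have "\<dots> = card ((\<lambda>(u, v). {u, v}) ` ?A)"
    by (rule card_image[symmetric]) (auto simp: inj_on_def doubleton_eq_iff)
  also have "(\<lambda>(u, v). {u, v}) ` ?A = E"
  proof (intro set_eqI iffI)
    fix e assume "e \<in> E"
    then obtain u v where "e = {u, v}" "u < v" "v < n"
      by (rule simple_graph_edge[OF assms])
    then show "e \<in> (\<lambda>(u, v). {u, v}) ` ?A"
      using \<open>e \<in> E\<close> by (intro image_eqI[of _ _ "(u, v)"]) auto
  qed auto
  finally show ?thesis .
qed

text \<open>The edges of a perfect matching cover all \<open>n\<close> vertices, and each covers
  only two.\<close>

lemma PM_zero:
  fixes E :: "nat set set"
  assumes graph: "simple_graph {..<n} E" and few: "2 * card E < n"
  shows "PM {..<n} E = 0"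
proof -
  have False if pm: "perfect_matching {..<n} E M" for M
  proof -
    have M: "M \<subseteq> E" "{..<n} \<subseteq> \<Union> M"
      using pm unfolding perfect_matching_def by auto
    have fin: "finite M"
      using M(1) finite_edges[OF graph] by (rule finite_subset)
    have "finite e" if "e \<in> M" for e
      using M(1) graph that finite_subset unfolding simple_graph_def by blast
    then have "finite (\<Union> M)"
      using fin by blast
    then have "n \<le> card (\<Union> M)"
      using card_mono[OF _ M(2)] by simp
    also have "\<dots> \<le> (\<Sum>e\<in>M. card e)"
      by (rule card_Union_le_sum_card)
    also have "\<dots> = (\<Sum>e\<in>M. 2)"
      using M(1) graph by (intro sum.cong) (auto simp: simple_graph_def)
    also have "\<dots> \<le> 2 * card E"
      using card_mono[OF finite_edges[OF graph] M(1)] by simp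
    finally show False
      using few by simp
  qed
  then show ?thesis
    unfolding PM_def by (metis (mono_tags, lifting) card.empty Collect_empty_eq)
qed

lemma ST_no_edges: "ST V {} ends c 1 = 0"
proof -
  have "{T. spanning_tree V {} ends T \<and> sum c T = 1} = {}"
    unfolding spanning_tree_def by auto
  then show ?thesis
    unfolding ST_def by (simp only: card.empty)
qed

lemma PM_single_edge:
  assumes "simple_graph {..<2 :: nat} E" "E \<noteq> {}"
  shows "PM {..<2} E = 1"
proof -
  have E: "E = {{0, 1}}"
  proof -
    have "e = {0, 1}" if e: "e \<in> E" for e
    proof -
      obtain u v where "e = {u, v}" "u < v" "v < 2"
        by (rule simple_graph_edge[OF assms(1) e])
      then show ?thesis
        by (auto simp: less_2_cases_iff)
    qed
    then show ?thesis
      using assms(2) by blast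
  qed
  have "perfect_matching {..<2} E {{0, 1}}"
    unfolding perfect_matching_def E
    by (intro conjI ballI ex1I[of _ "{0, 1}"]) (simp_all add: less_2_cases_iff)
  moreover have "\<not> perfect_matching {..<2 :: nat} E {}"
    unfolding perfect_matching_def by (simp add: Ex1_def) (rule exI[of _ 0], simp)
  moreover have "M = {} \<or> M = {{0, 1}}" if "perfect_matching {..<2} E M" for M
  proof -
    have "M \<subseteq> {{0, 1}}"
      using that unfolding perfect_matching_def E by (rule conjunct1)
    then show ?thesis
      by (rule subset_singletonD)
  qed
  ultimately have eq: "{M. perfect_matching {..<2} E M} = {{{0, 1}}}"
    by blast
  show ?thesis
    unfolding PM_def eq by simp
qed

text \<open>Each single edge is a tree by the criterion for unique upper edges, while both together
  form a cycle of length 2.\<close>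

lemma ST_parallel_edges:
  defines "es \<equiv> [(0, 1, 0), (0, 1, 0)]"
  shows "ST {..<2} {..<length es} (edge_ends es) (edge_cost es) 0 = 2"
proof -
  have ends: "edge_ends es i = {0, 1}" and cost: "edge_cost es i = 0" if "i < 2" for i
    using that unfolding edge_ends_def edge_cost_def es_def by (auto simp: less_2_cases_iff)
  have len: "length es = 2"
    unfolding es_def by simp
  have trees: "spanning_tree {..<2} {..<2} (edge_ends es) T \<longleftrightarrow> T = {0} \<or> T = {1}" for T :: "nat set"
  proof
    assume T: "spanning_tree {..<2} {..<2} (edge_ends es) T"
    have "T \<noteq> {}"
    proof
      assume "T = {}"
      then have h: "\<forall>u\<in>{..<2 :: nat}. \<forall>v\<in>{..<2}. u = v"
        using T unfolding spanning_tree_def connected_by_def by simp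
      show False
        using h[rule_format, of 0 1] by simp
    qed
    moreover have "T \<noteq> {0, 1}"
    proof
      assume "T = {0, 1}"
      moreover have "edge_ends es ([0, 1] ! i) = {[0, 1] ! i, [0, 1] ! (Suc i mod 2)}"
        if "i < 2" for i
      proof -
        have "i = 0 \<or> i = 1"
          using that by (simp add: less_2_cases_iff)
        then show ?thesis
          by (elim disjE) (simp_all add: ends insert_commute)
      qed
      ultimately have "cycle_in (edge_ends es) T [0, 1] [0, 1]"
        unfolding cycle_in_def by (simp add: numeral_2_eq_2)
      then show False
        using T unfolding spanning_tree_def by blast
    qed
    moreover have "T \<subseteq> {0, 1}"
      using T unfolding spanning_tree_def by (auto simp: less_2_cases_iff)
    ultimately show "T = {0} \<or> T = {1}"
      by blast
  next
    assume T: "T = {0} \<or> T = {1}"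
    show "spanning_tree {..<2} {..<2} (edge_ends es) T"
      by (rule spanning_tree_if_unique_upper_edge)
        (use T in \<open>auto simp: ends less_2_cases_iff\<close>)
  qed
  have zero: "T = {0} \<or> T = {1} \<Longrightarrow> sum (edge_cost es) T = 0" for T
    by (elim disjE) (simp_all add: cost)
  have eq: "{T. spanning_tree {..<2} {..<length es} (edge_ends es) T \<and>
      sum (edge_cost es) T = 0} = {{0}, {1}}"
  proof (rule set_eqI)
    fix T show "T \<in> {T. spanning_tree {..<2} {..<length es} (edge_ends es) T \<and>
        sum (edge_cost es) T = 0} \<longleftrightarrow> T \<in> {{0}, {1}}"
      unfolding len mem_Collect_eq trees insert_iff empty_iff using zero[of T] by iprover
  qed
  show ?thesis
    unfolding ST_def eq by simp
qed

section \<open>The size of the costs and the factor alpha\<close>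

lemma label_edge_bound:
  assumes "is_label n E l" "1 \<le> b"
  shows "snd (snd (label_edge b l)) \<le> 7 * b ^ n"
proof -
  have p: "b ^ u \<le> b ^ n" if "u < n" for u
    using that assms(2) by (intro power_increasing) auto
  have "1 \<le> b ^ n"
    using assms(2) by simp
  then show ?thesis
    using assms(1)
  proof (cases l)
    case (Match u v)
    then show ?thesis
      using assms(1) p[of u] p[of v] by (simp add: is_label_def)
  next
    case (Flag u)
    then show ?thesis
      using assms(1) p[of u] \<open>1 \<le> b ^ n\<close> by (simp add: is_label_def)
  next
    case (Star u)
    then show ?thesis
      using assms(1) p[of u] by (simp add: is_label_def)
  qed
qed

text \<open>There are at most \<open>n * (3 * n + 8)\<close> edges, hence at most
  \<open>11 * n ^ 2\<close>. Each costs at most \<open>7 * (64 * n) ^ n\<close>, where 7 is 2 + 5,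
  the sum of the digits of a matching edge.\<close>

lemma gadget_cost:
  assumes "n \<ge> 1"
  shows "(\<Sum>i<length (gadget (64 * n) n E n). edge_cost (gadget (64 * n) n E n) i)
    \<le> 77 * n\<^sup>2 * (64 * n) ^ n"
proof -
  let ?es = "gadget (64 * n) n E n"
  have "edge_cost ?es i \<le> 7 * (64 * n) ^ n" if "i < length ?es" for i
  proof -
    have i: "i < length (labels n E)"
      using that by (simp add: gadget_eq_labels)
    then have "is_label n E (labels n E ! i)"
      using set_labels nth_mem by blast
    from label_edge_bound[OF this, of "64 * n"] show ?thesis
      using i assms unfolding edge_cost_def gadget_eq_labels by (simp add: case_prod_unfold)
  qed
  then have "(\<Sum>i<length ?es. edge_cost ?es i) \<le> length ?es * (7 * (64 * n) ^ n)"
    using sum_bounded_above[of "{..<length ?es}" "edge_cost ?es" "7 * (64 * n) ^ n"] by simp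
  also have "\<dots> \<le> (n * (3 * n + 8)) * (7 * (64 * n) ^ n)"
    by (intro mult_right_mono length_gadget) simp
  also have "\<dots> \<le> (11 * n\<^sup>2) * (7 * (64 * n) ^ n)"
    using assms by (intro mult_right_mono) (auto simp: power2_eq_square algebra_simps)
  finally show ?thesis
    by (simp add: mult.assoc mult.left_commute)
qed

lemma gadget_multigraph:
  assumes "n \<ge> 3"
  shows "multigraph {..<n} {..<length (gadget (64 * n) n E n)} (edge_ends (gadget (64 * n) n E n))"
proof -
  have "edge_ends (gadget (64 * n) n E n) i \<subseteq> {..<n} \<and> card (edge_ends (gadget (64 * n) n E n) i) = 2"
    if "i < length (labels n E)" for i
  proof -
    have "is_label n E (labels n E ! i)"
      using that set_labels nth_mem by blast
    then show ?thesis
      unfolding edge_ends_gadget[OF that] using assms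
      by (cases "labels n E ! i") (auto simp: is_label_def)
  qed
  then show ?thesis
    unfolding multigraph_def by (simp add: gadget_eq_labels)
qed

text \<open>With \<open>n = 2 * k\<close> the product is \<open>4 * n ^ 2 / (2 * n) ^ 2\<close>. The
  bound on \<open>k\<close> makes \<open>k - 2\<close> a true subtraction.\<close>

lemma alpha_times_count:
  assumes "n = 2 * k" "k \<ge> 2"
  shows "(real n)\<^sup>2 / 2 * (2 * real n) powr (- real n / 2) * (8 * (2 * real n) ^ (k - 2)) = 1"
proof -
  have pos: "2 * real n > 0"
    using assms by simp
  have "(2 * real n) powr (- real n / 2) = inverse ((2 * real n) ^ k)"
    using assms(1) pos by (simp add: powr_minus powr_realpow)
  moreover have "(2 * real n) ^ k = (2 * real n) ^ (k - 2) * (2 * real n)\<^sup>2"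
    unfolding power_add[symmetric] using assms(2) by (intro arg_cong[where f = "power _"]) simp
  moreover obtain p where p: "(2 * real n) ^ (k - 2) = p" "p > 0"
    using pos by (simp only: zero_less_power)
  ultimately have "(2 * real n) powr (- real n / 2) = inverse (p * (2 * real n)\<^sup>2)"
    by (simp only:)
  then show ?thesis
    using pos p(2) unfolding p(1) by (simp add: field_simps power2_eq_square)
qed

text \<open>This turns the exponent \<open>n div 2\<close> of the count into the
  \<open>n / 2\<close> of alpha.\<close>

lemma even_if_perfect_matching:
  fixes E :: "nat set set"
  assumes "n \<ge> 3" "simple_graph {..<n} E" "PM {..<n} E \<noteq> 0"
  shows "even n"
proof -
  have "{M. perfect_matching {..<n} E M} \<noteq> {}"
    using assms(3) unfolding PM_def by (metis card.empty)
  then obtain M where "perfect_matching {..<n} E M"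
    by blast
  then interpret matching n E M
    using assms by unfold_locales
  show ?thesis
    using card_lower_ends by simp
qed

theorem theorem7p1:
  shows "\<exists>(R :: graph \<Rightarrow> st_instance) (K :: real) (f :: nat \<Rightarrow> real).
    polytime_computable graphs encode_graph encode_st_instance R \<and>
    f \<in> O(\<lambda>m. real m * log 2 (real m)) \<and>
    (\<forall>(n, E) \<in> graphs. \<exists>es C.
      R (n, E) = (n, es, C) \<and>
      multigraph {..<n} {..<length es} (edge_ends es) \<and>
      real (length es) \<le> K * (real (card E) + (real n)\<^sup>2) \<and>
      real (\<Sum>i<length es. edge_cost es i) \<le> 2 powr f (card E) \<and>
      real (PM {..<n} E) =
        ((real n)\<^sup>2 / 2 * (2 * real n) powr (- real n / 2)) *
        real (ST {..<n} {..<length es} (edge_ends es) (edge_cost es) C))"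
proof -
  \<comment> \<open>Inserting \<open>n <= 2 * m\<close> into the bound of \<open>gadget_cost\<close>
    gives \<open>2 ^ 9 * m ^ 2 * (128 * m) ^ (2 * m)\<close>, and \<open>f\<close> is the binary
    logarithm of this for positive \<open>m\<close>.\<close>
  define f :: "nat \<Rightarrow> real" where
    "f m = 9 + 2 * log 2 (real m) + 2 * real m * (7 + log 2 (real m))" for m
  have f: "f \<in> O(\<lambda>m. real m * log 2 (real m))"
    unfolding f_def by real_asymp
  have "\<exists>es C. reduction (n, E) = (n, es, C) \<and>
      multigraph {..<n} {..<length es} (edge_ends es) \<and>
      real (length es) \<le> 11 * (real (card E) + (real n)\<^sup>2) \<and>
      real (\<Sum>i<length es. edge_cost es i) \<le> 2 powr f (card E) \<and>
      real (PM {..<n} E) =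
        ((real n)\<^sup>2 / 2 * (2 * real n) powr (- real n / 2)) *
        real (ST {..<n} {..<length es} (edge_ends es) (edge_cost es) C)"
    if "(n, E) \<in> graphs" for n E
  proof -
    have graph: "simple_graph {..<n} E" and n: "n \<ge> 1"
      using that unfolding graphs_def by auto
    note count = edge_count_eq_card[OF graph]
    consider "2 * card E < n" | "2 * card E \<ge> n" "n \<le> 2" | "2 * card E \<ge> n" "n \<ge> 3"
      by linarith
    then show ?thesis
    proof cases
      case 1
      then have "reduction (n, E) = (n, [], 1)"
        unfolding reduction_def by (simp add: count)
      moreover have "multigraph {..<n} {..<length []} (edge_ends [])"
        unfolding multigraph_def by simp
      moreover have "ST {..<n} {..<length []} (edge_ends []) (edge_cost []) 1 = 0"
        unfolding list.size lessThan_0 by (rule ST_no_edges)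
      ultimately show ?thesis
        using PM_zero[OF graph 1] by (intro exI[of _ "[]"] exI[of _ 1]) simp
    next
      case 2
      let ?es = "[(0, 1, 0), (0, 1, 0)] :: edge list"
      have "E \<noteq> {}"
        using 2 n by auto
      then obtain e where e: "e \<in> E"
        by blast
      \<comment> \<open>An edge needs two vertices, which excludes \<open>n = 1\<close>.\<close>
      obtain u v where "u < v" "v < n"
        by (rule simple_graph_edge[OF graph e])
      then have "n = 2"
        using 2(2) by linarith
      have red: "reduction (n, E) = (n, ?es, 0)"
        using 2 unfolding reduction_def by (simp add: count)
      have ends: "edge_ends ?es i = {0, 1}" and cost: "edge_cost ?es i = 0" if "i < 2" for i
        using that unfolding edge_ends_def edge_cost_def by (auto simp: less_2_cases_iff)
      have "multigraph {..<n} {..<length ?es} (edge_ends ?es)"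
        unfolding multigraph_def using ends \<open>n = 2\<close> by auto
      moreover have "real (PM {..<n} E) = ((real n)\<^sup>2 / 2 * (2 * real n) powr (- real n / 2)) *
          real (ST {..<n} {..<length ?es} (edge_ends ?es) (edge_cost ?es) 0)"
        using PM_single_edge[OF graph[unfolded \<open>n = 2\<close>] \<open>E \<noteq> {}\<close>] ST_parallel_edges
        unfolding \<open>n = 2\<close> by (simp add: powr_minus)
      moreover have "(\<Sum>i<length ?es. edge_cost ?es i) = 0"
        using cost by simp
      moreover have "real (length ?es) \<le> 11 * (real (card E) + (real n)\<^sup>2)"
        using \<open>n = 2\<close> by simp
      ultimately show ?thesis
        using red by (intro exI[of _ ?es] exI[of _ 0]) (simp del: length_Cons list.size)
    next
      case 3
      let ?es = "gadget (64 * n) n E n" and ?m = "card E"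
      have red: "reduction (n, E) = (n, ?es, 5 * (\<Sum>u<n. (64 * n) ^ u))"
        using 3 unfolding reduction_def by (simp add: count)
      \<comment> \<open>Having at least \<open>n / 2\<close> edges is what allows a cost bound in
        terms of \<open>m\<close> alone.\<close>
      have m: "real ?m \<ge> 1" "real n \<le> 2 * real ?m"
        using 3 by auto
      have "length ?es \<le> n * (3 * n + 8)"
        by (rule length_gadget)
      also have "\<dots> \<le> 11 * n\<^sup>2"
        using n by (simp add: power2_eq_square algebra_simps)
      finally have "real (length ?es) \<le> real (11 * n\<^sup>2)"
        by (rule of_nat_mono)
      then have len: "real (length ?es) \<le> 11 * (real ?m + (real n)\<^sup>2)"
        by simp
      have "real (\<Sum>i<length ?es. edge_cost ?es i) \<le> real (77 * n\<^sup>2 * (64 * n) ^ n)"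
        using gadget_cost[OF n] by (rule of_nat_mono)
      also have "\<dots> = 77 * (real n)\<^sup>2 * (64 * real n) ^ n"
        by simp
      also have "\<dots> \<le> 77 * (2 * real ?m)\<^sup>2 * (128 * real ?m) ^ n"
      proof (intro mult_mono order_refl)
        show "(real n)\<^sup>2 \<le> (2 * real ?m)\<^sup>2"
          using m(2) by (rule power_mono) simp
        show "(64 * real n) ^ n \<le> (128 * real ?m) ^ n"
          using m(2) by (intro power_mono) simp_all
      qed auto
      also have "\<dots> \<le> 77 * (2 * real ?m)\<^sup>2 * (128 * real ?m) ^ (2 * ?m)"
        using m 3 by (intro mult_left_mono power_increasing) auto
      \<comment> \<open>\<open>77 * 4 = 308\<close> is at most 512.\<close>
      also have "\<dots> \<le> 2 powr 9 * (real ?m)\<^sup>2 * (128 * real ?m) ^ (2 * ?m)"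
        by (intro mult_right_mono) (auto simp: power_mult_distrib)
      also have "\<dots> = 2 powr f ?m"
      proof -
        have base: "2 powr (7 + log 2 (real ?m)) = 128 * real ?m"
          using m by (simp add: powr_add)
        have "(128 * real ?m) ^ (2 * ?m) = (128 * real ?m) powr real (2 * ?m)"
          using m by (intro powr_realpow[symmetric]) simp
        also have "\<dots> = 2 powr ((7 + log 2 (real ?m)) * real (2 * ?m))"
          unfolding base[symmetric] by (rule powr_powr)
        also have "(7 + log 2 (real ?m)) * real (2 * ?m) = 2 * real ?m * (7 + log 2 (real ?m))"
          by simp
        finally have "(128 * real ?m) ^ (2 * ?m) = 2 powr (2 * real ?m * (7 + log 2 (real ?m)))" .
        moreover have "(real ?m)\<^sup>2 = 2 powr (2 * log 2 (real ?m))"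
        proof -
          have "2 powr (log 2 (real ?m) * 2) = (2 powr log 2 (real ?m)) powr 2"
            by (rule powr_powr[symmetric])
          then show ?thesis
            using m by (simp add: mult.commute[of 2])
        qed
        ultimately show ?thesis
          unfolding f_def by (simp only: powr_add)
      qed
      finally have cost: "real (\<Sum>i<length ?es. edge_cost ?es i) \<le> 2 powr f ?m" .
      have "real (PM {..<n} E) = ((real n)\<^sup>2 / 2 * (2 * real n) powr (- real n / 2)) *
          real (PM {..<n} E * (8 * (2 * n) ^ (n div 2 - 2)))"
      \<comment> \<open>Without perfect matchings both sides vanish, whatever the parity of
        \<open>n\<close>.\<close>
      proof (cases "PM {..<n} E = 0")
        case False
        then obtain k where k: "n = 2 * k"
          using even_if_perfect_matching[OF 3(2) graph False] by (elim evenE)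
        then have "k \<ge> 2"
          using 3 by simp
        from alpha_times_count[OF k this] show ?thesis
          using k by (simp add: algebra_simps)
      qed simp
      then show ?thesis
        using red gadget_multigraph[OF 3(2)] len cost unfolding ST_gadget[OF 3(2) graph, symmetric]
        by blast
    qed
  qed
  then show ?thesis
    using reduction_polytime f by (intro exI[of _ reduction] exI[of _ 11] exI[of _ f]) auto
qed

end
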